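(* Let $n\ge 0$ and let $\big(\mathrm{C}_\bullet(\mathbf{\Delta}^n;\mathbb{F}_2),\Delta,\varepsilon\big)$ be the Steenrod cup-$i$ coalgebra associated to the $n$-th representable simplicial set $\mathbf{\Delta}^n$. Then $$\xi\big(\mathrm{C}_\bullet(\mathbf{\Delta}^n;\mathbb{F}_2),\Delta,\varepsilon\big)=\mathcal{O}_n,$$ where $\mathcal{O}_n$ is Street's $n$-th oriental; the two $\omega$-categories are identified by an isomorphism of $\omega$-categories $\mathcal{O}_n\to\xi\big(\mathrm{C}_\bullet(\mathbf{\Delta}^n;\mathbb{F}_2),\Delta,\varepsilon\big)$ given by reduction of coefficients modulo $2$, $\mu(\mathrm{C}_\bullet(\mathbf{\Delta}^n;\mathbb{Z}))\to\mu(\mathrm{C}_\bullet(\mathbf{\Delta}^n;\mathbb{F}_2))$.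
   Context: **$\omega$-categories.** An $\omega$-category is a strict one: a reflexive globular set $X$ (sets $X_n$, $n\ge0$, source and target maps $s_m,t_m:X_n\to X_m$ for $m<n$, identity maps $i_n:X_{n-1}\to X_n$) with compositions $y\circ_m x\in X_n$ for $m<n$ and $x,y\in X_n$ with $s_m(y)=t_m(x)$, satisfying the usual associativity, unit and interchange laws. One also writes $y\circ_z x$ for $y\circ_m x$ when $z=t_m(x)=s_m(y)$. **The functor $\mu$.** For a commutative unital ring $R$ and a non-negatively graded differential graded $R$-module $C$, $\mu(C)$ is the set (an $R$-module) of sequences $c=(c_0^-,c_0^+,c_1^-,c_1^+,\dots)$ with $c_n^\pm\in C_n$, $c_n^\pm=0$ for $n\gg0$, and $\partial c_{n+1}^-=\partial c_{n+1}^+=c_n^+-c_n^-$ for all $n\ge 0$. It is an $\omega$-category with $\mu(C)_n=\{c: c_k^\pm=0\ \forall k>n\}$, $s_k(c)=(c_0^-,c_0^+,\dots,c_{k-1}^-,c_{k-1}^+,c_k^-,c_k^-,0,0,\dots)$, $t_k(c)=(c_0^-,c_0^+,\dots,c_{k-1}^-,c_{k-1}^+,c_k^+,c_k^+,0,0,\dots)$, $i_k(c)=c$, and $b\circ_c a=b+a-c$ (termwise), where $c$ is the common value of the target of $a$ and the source of $b$. **Steenrod cup-$i$ coalgebra.** For a simplicial set $X$, $\mathrm{C}_\bullet(X;\mathbb{F}_2)$ denotes normalized chains. Let $P\binom{m}{k}$ be the set of all $U=\{0\le u_1<\dots<u_k\le m\}$ (empty if $k<0$; consisting of $\emptyset$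 if $k=0$), put $d_U=d_{u_1}\cdots d_{u_k}$ (composition of face maps, $d_\emptyset=\mathrm{id}$), $U^-=\{u_j\in U: u_j\not\equiv j \bmod 2\}$, $U^+=\{u_j\in U: u_j\equiv j\bmod 2\}$. For $x\in X_m$, $$\Delta_i(x)=\sum_{U\in P\binom{m}{m-i}}d_{U^-}x\otimes d_{U^+}x,\qquad \varepsilon(x)=1\text{ if }m=0,\ \varepsilon(x)=0\text{ if }m\neq0 .$$ The maps $\Delta_i$, $i\ge0$, define the coalgebra structure. The non-degenerate simplices form a basis of group-like elements, where an element $c$ of degree $m$ is group-like if $\Delta_k(c)\in C_{\le m}\otimes C_{\le m}$ for all $k$ (with $C_{\le m}=C_0\oplus\cdots\oplus C_m$), $\Delta_m(c)=c\otimes c$, and $\varepsilon(c)=1$ if $m=0$. **The construction $\xi$.** Let $C$ be such a coalgebra over $R$ (here $R=\mathbb{F}_2$) with a basis $B$ of group-like elements. For $b\in B$ let $\pi_b:C\to R$ be the $R$-linear map with $\pi_b(b)=1$ and $\pi_b(b')=0$ for $b'\in B\setminus\{b\}$. Put $\pi_b^+=\mathrm{id}\otimes\pi_b:C\otimes C\to C$ and $\pi_b^-=\pi_b^+T$, where $T(x\otimes y)=(-1)^{|x||y|}y\otimes x$. The atom of $b$ is $\langle b\rangle=(\langle b\rangle_0^-,\langle b\rangle_0^+,\langle b\rangle_1^-,\langle b\rangle_1^+,\dots)\in\mu(C)$ with $\langle b\rangle_k^-=(-1)^k\pi_b^-\Delta_k b$ and $\langle b\rangle_k^+=\pi_b^+\Delta_k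 b$. Then $\xi(C)$ is the sub-$\omega$-category of $\mu(C)$ generated by the atoms $\langle b\rangle\in\mu(C)_{|b|}$, $b\in B$. **Orientals (Steiner's definition).** Let $C=\mathrm{C}_\bullet(\mathbf{\Delta}^n;\mathbb{Z})$ be the normalized integral chains, with canonical basis $B$ the injective order-preserving maps $[m]\to[n]$. Each $c\in C$ decomposes canonically as $c=c^+-c^-$, where $c^+$ and $c^-$ are non-negative combinations of basis elements with no basis element in common. For $b\in B$ of degree $m$ define $b_i^\pm=0$ for $i>m$, $b_m^\pm=b$, and recursively $b_i^+=(\partial b_{i+1}^+)^+$, $b_i^-=(\partial b_{i+1}^-)^-$ for $i<m$. The Steiner atom of $b$ is $(b_0^-,b_0^+,b_1^-,b_1^+,\dots)\in\mu(C)_m$. The oriental $\mathcal{O}_n$ is the sub-$\omega$-category of $\mu(C)$ generated by the Steiner atoms of all $b\in B$. *)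

theory Defs
  imports Main "HOL-Library.Poly_Mapping" "HOL-Library.Z2"
begin

section \<open>Strict \<open>\<omega>\<close>-categories\<close>

text \<open>
  The sets of cells \<open>X\<^sub>n\<close> need not be disjoint, so the structure maps carry the dimension of
  their argument: \<open>src X n m\<close> and \<open>tgt X n m\<close> are the maps \<open>s\<^sub>m, t\<^sub>m : X\<^sub>n \<rightarrow> X\<^sub>m\<close> (for \<open>m < n\<close>),
  \<open>idt X n\<close> is \<open>i\<^sub>n : X\<^bsub>n-1\<^esub> \<rightarrow> X\<^sub>n\<close> (for \<open>n > 0\<close>), and \<open>comp X n m y x\<close> is \<open>y \<circ>\<^sub>m x\<close> in \<open>X\<^sub>n\<close>.
\<close>

record 'a omega_data =
  cells :: "nat \<Rightarrow> 'a set"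
  src :: "nat \<Rightarrow> nat \<Rightarrow> 'a \<Rightarrow> 'a"
  tgt :: "nat \<Rightarrow> nat \<Rightarrow> 'a \<Rightarrow> 'a"
  idt :: "nat \<Rightarrow> 'a \<Rightarrow> 'a"
  comp :: "nat \<Rightarrow> nat \<Rightarrow> 'a \<Rightarrow> 'a \<Rightarrow> 'a"

definition composable :: "('a, 'z) omega_data_scheme \<Rightarrow> nat \<Rightarrow> nat \<Rightarrow> 'a \<Rightarrow> 'a \<Rightarrow> bool" where
  "composable X n m y x \<longleftrightarrow>
     m < n \<and> x \<in> cells X n \<and> y \<in> cells X n \<and> src X n m y = tgt X n m x"

text \<open>\<open>iter_idt X m k x\<close> is the \<open>(m+k)\<close>-cell obtained from the \<open>m\<close>-cell \<open>x\<close>.\<close>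

primrec iter_idt :: "('a, 'z) omega_data_scheme \<Rightarrow> nat \<Rightarrow> nat \<Rightarrow> 'a \<Rightarrow> 'a" where
  "iter_idt X m 0 x = x"
| "iter_idt X m (Suc k) x = idt X (Suc (m + k)) (iter_idt X m k x)"

text \<open>
  Cases such as \<open>s\<^sub>k (y \<circ>\<^sub>m x)\<close> with \<open>k < m\<close>, or \<open>s\<^sub>k (i\<^sub>n x)\<close> with \<open>k < n - 1\<close>, follow from the
  axioms below by globularity.
\<close>

locale omega_category =
  fixes X :: "('a, 'z) omega_data_scheme"
  assumes src_cell: "\<lbrakk>m < n; x \<in> cells X n\<rbrakk> \<Longrightarrow> src X n m x \<in> cells X m"
    and tgt_cell: "\<lbrakk>m < n; x \<in> cells X n\<rbrakk> \<Longrightarrow> tgt X n m x \<in> cells X m"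
    and idt_cell: "x \<in> cells X n \<Longrightarrow> idt X (Suc n) x \<in> cells X (Suc n)"
    and src_src: "\<lbrakk>k < m; m < n; x \<in> cells X n\<rbrakk> \<Longrightarrow> src X m k (src X n m x) = src X n k x"
    and src_tgt: "\<lbrakk>k < m; m < n; x \<in> cells X n\<rbrakk> \<Longrightarrow> src X m k (tgt X n m x) = src X n k x"
    and tgt_src: "\<lbrakk>k < m; m < n; x \<in> cells X n\<rbrakk> \<Longrightarrow> tgt X m k (src X n m x) = tgt X n k x"
    and tgt_tgt: "\<lbrakk>k < m; m < n; x \<in> cells X n\<rbrakk> \<Longrightarrow> tgt X m k (tgt X n m x) = tgt X n k x"
    and src_idt: "x \<in> cells X n \<Longrightarrow> src X (Suc n) n (idt X (Suc n) x) = x"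
    and tgt_idt: "x \<in> cells X n \<Longrightarrow> tgt X (Suc n) n (idt X (Suc n) x) = x"
    and comp_cell: "composable X n m y x \<Longrightarrow> comp X n m y x \<in> cells X n"
    and src_comp: "composable X n m y x \<Longrightarrow> src X n m (comp X n m y x) = src X n m x"
    and tgt_comp: "composable X n m y x \<Longrightarrow> tgt X n m (comp X n m y x) = tgt X n m y"
    and src_comp_above: "\<lbrakk>composable X n m y x; m < k; k < n\<rbrakk> \<Longrightarrow>
          src X n k (comp X n m y x) = comp X k m (src X n k y) (src X n k x)"
    and tgt_comp_above: "\<lbrakk>composable X n m y x; m < k; k < n\<rbrakk> \<Longrightarrow>
          tgt X n k (comp X n m y x) = comp X k m (tgt X n k y) (tgt X n k x)"
    and comp_assoc: "\<lbrakk>composable X n m z y; composable X n m y x\<rbrakk> \<Longrightarrow>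
          comp X n m (comp X n m z y) x = comp X n m z (comp X n m y x)"
    and comp_unit_src: "\<lbrakk>m < n; x \<in> cells X n\<rbrakk> \<Longrightarrow>
          comp X n m x (iter_idt X m (n - m) (src X n m x)) = x"
    and comp_unit_tgt: "\<lbrakk>m < n; x \<in> cells X n\<rbrakk> \<Longrightarrow>
          comp X n m (iter_idt X m (n - m) (tgt X n m x)) x = x"
    and idt_comp: "composable X n m y x \<Longrightarrow>
          idt X (Suc n) (comp X n m y x)
            = comp X (Suc n) m (idt X (Suc n) y) (idt X (Suc n) x)"
    and interchange: "\<lbrakk>k < m; composable X n m y' y; composable X n m x' x;
          composable X n k y' x'; composable X n k y x\<rbrakk> \<Longrightarrow>
          comp X n k (comp X n m y' y) (comp X n m x' x)
            = comp X n m (comp X n k y' x') (comp X n k y x)"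

locale omega_functor = X: omega_category X + Y: omega_category Y
  for X :: "('a, 'y) omega_data_scheme" and Y :: "('b, 'z) omega_data_scheme" +
  fixes F :: "nat \<Rightarrow> 'a \<Rightarrow> 'b"
  assumes map_cell: "x \<in> cells X n \<Longrightarrow> F n x \<in> cells Y n"
    and map_src: "\<lbrakk>m < n; x \<in> cells X n\<rbrakk> \<Longrightarrow> F m (src X n m x) = src Y n m (F n x)"
    and map_tgt: "\<lbrakk>m < n; x \<in> cells X n\<rbrakk> \<Longrightarrow> F m (tgt X n m x) = tgt Y n m (F n x)"
    and map_idt: "x \<in> cells X n \<Longrightarrow> F (Suc n) (idt X (Suc n) x) = idt Y (Suc n) (F n x)"
    and map_comp: "composable X n m y x \<Longrightarrow>
          F n (comp X n m y x) = comp Y n m (F n y) (F n x)"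

definition omega_iso ::
  "('a, 'y) omega_data_scheme \<Rightarrow> ('b, 'z) omega_data_scheme \<Rightarrow> (nat \<Rightarrow> 'a \<Rightarrow> 'b) \<Rightarrow> bool" where
  "omega_iso X Y F \<longleftrightarrow> omega_functor X Y F \<and>
     (\<exists>G. omega_functor Y X G \<and>
        (\<forall>n. \<forall>x \<in> cells X n. G n (F n x) = x) \<and> (\<forall>n. \<forall>y \<in> cells Y n. F n (G n y) = y))"

inductive generated_cell ::
  "('a, 'z) omega_data_scheme \<Rightarrow> (nat \<Rightarrow> 'a set) \<Rightarrow> nat \<Rightarrow> 'a \<Rightarrow> bool"
  for X :: "('a, 'z) omega_data_scheme" and S :: "nat \<Rightarrow> 'a set" where
  gen: "x \<in> S n \<Longrightarrow> generated_cell X S n x"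
| gen_src: "\<lbrakk>generated_cell X S n x; m < n\<rbrakk> \<Longrightarrow> generated_cell X S m (src X n m x)"
| gen_tgt: "\<lbrakk>generated_cell X S n x; m < n\<rbrakk> \<Longrightarrow> generated_cell X S m (tgt X n m x)"
| gen_idt: "generated_cell X S n x \<Longrightarrow> generated_cell X S (Suc n) (idt X (Suc n) x)"
| gen_comp: "\<lbrakk>generated_cell X S n x; generated_cell X S n y; m < n; src X n m y = tgt X n m x\<rbrakk>
    \<Longrightarrow> generated_cell X S n (comp X n m y x)"

definition sub_omega_generated ::
  "('a, 'z) omega_data_scheme \<Rightarrow> (nat \<Rightarrow> 'a set) \<Rightarrow> ('a, 'z) omega_data_scheme" where
  "sub_omega_generated X S = X\<lparr>cells := \<lambda>n. {x. generated_cell X S n x}\<rparr>"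

lemma omega_category_generated:
  assumes "omega_category X" "\<And>n. S n \<subseteq> cells X n"
  shows "omega_category (sub_omega_generated X S)"
proof -
  interpret omega_category X by fact
  have g: "generated_cell X S n x \<Longrightarrow> x \<in> cells X n" for n x
    by (induction rule: generated_cell.induct)
      (use assms in \<open>auto simp: src_cell tgt_cell idt_cell composable_def intro!: comp_cell\<close>)
  have it: "iter_idt (sub_omega_generated X S) m k x = iter_idt X m k x" for m k x
    by (induction k) (auto simp: sub_omega_generated_def)
  have cc: "composable (sub_omega_generated X S) n m y x \<Longrightarrow> composable X n m y x" for n m y x
    using g by (auto simp: composable_def sub_omega_generated_def)
  have f: "src (sub_omega_generated X S) = src X" "tgt (sub_omega_generated X S) = tgt X"
    "idt (sub_omega_generated X S) = idt X"
    "comp (sub_omega_generated X S) = comp X"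
    "cells (sub_omega_generated X S) n = {x. generated_cell X S n x}" for n
    by (auto simp: sub_omega_generated_def)
  show ?thesis
    by unfold_locales
      (use g cc in \<open>auto simp: it f src_cell tgt_cell idt_cell src_src src_tgt tgt_src tgt_tgt src_idt tgt_idt src_comp tgt_comp src_comp_above tgt_comp_above
        comp_assoc comp_unit_src comp_unit_tgt idt_comp intro: generated_cell.intros\<close>,
       (auto simp: composable_def f intro: generated_cell.intros)?,
  (rule interchange; use g in \<open>simp add: composable_def\<close>)?)
qed


section \<open>The functor \<open>\<mu>\<close>\<close>

text \<open>
  A non-negatively graded differential graded module is given by its homogeneous components,
  all lying in one ambient abelian group, and by its differential.
\<close>

record 'c dg_module =
  component :: "nat \<Rightarrow> 'c set"
  bd :: "'c \<Rightarrow> 'c"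

datatype polarity = Neg | Pos

type_synonym 'c mu_seq = "nat \<Rightarrow> polarity \<Rightarrow> 'c"

definition mu_carrier :: "('c::ab_group_add, 'z) dg_module_scheme \<Rightarrow> 'c mu_seq set" where
  "mu_carrier C = {c.
     (\<forall>n \<alpha>. c n \<alpha> \<in> component C n) \<and>
     (\<exists>N. \<forall>n > N. \<forall>\<alpha>. c n \<alpha> = 0) \<and>
     (\<forall>n \<alpha>. bd C (c (Suc n) \<alpha>) = c n Pos - c n Neg)}"

definition mu_end :: "polarity \<Rightarrow> nat \<Rightarrow> 'c::ab_group_add mu_seq \<Rightarrow> 'c mu_seq" where
  "mu_end \<beta> k c = (\<lambda>j \<alpha>. if j < k then c j \<alpha> else if j = k then c k \<beta> else 0)"

definition mu :: "('c::ab_group_add, 'z) dg_module_scheme \<Rightarrow> 'c mu_seq omega_data" where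
  "mu C = \<lparr>
     cells = \<lambda>n. {c \<in> mu_carrier C. \<forall>k > n. \<forall>\<alpha>. c k \<alpha> = 0},
     src = \<lambda>n m. mu_end Neg m,
     tgt = \<lambda>n m. mu_end Pos m,
     idt = \<lambda>n c. c,
     comp = \<lambda>n m b a. \<lambda>j \<alpha>. b j \<alpha> + a j \<alpha> - mu_end Pos m a j \<alpha>\<rparr>"

definition mu_map :: "('c \<Rightarrow> 'd) \<Rightarrow> 'c mu_seq \<Rightarrow> 'd mu_seq" where
  "mu_map f c = (\<lambda>k \<alpha>. f (c k \<alpha>))"

lemma mu_carrierD:
  assumes "c \<in> mu_carrier C"
  shows "c n \<alpha> \<in> component C n" "bd C (c (Suc n) \<alpha>) = c n Pos - c n Neg"
  using assms by (auto simp: mu_carrier_def)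

lemma mu_top_eq:
  assumes "c \<in> cells (mu C) n" "bd C 0 = 0"
  shows "c n Pos = c n Neg"
proof -
  have "bd C (c (Suc n) Pos) = c n Pos - c n Neg" "c (Suc n) Pos = 0"
    using assms mu_carrierD(2)[of c C n Pos] by (simp_all add: mu_def)
  then show ?thesis using assms by simp
qed

lemma mu_omega_category:
  fixes C :: "('c::ab_group_add,'z) dg_module_scheme"
  assumes z: "\<And>n. 0 \<in> component C n"
    and ad: "\<And>n x y. x \<in> component C n \<Longrightarrow> y \<in> component C n \<Longrightarrow> x + y \<in> component C n"
    and di: "\<And>n x y. x \<in> component C n \<Longrightarrow> y \<in> component C n \<Longrightarrow> x - y \<in> component C n"
    and bz: "bd C 0 = 0" and ba: "\<And>x y. bd C (x + y) = bd C x + bd C y"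
    and bm: "\<And>x y. bd C (x - y) = bd C x - bd C y"
  shows "omega_category (mu C)"
proof -
  have E: "mu_end \<beta> m x \<in> cells (mu C) m" if "x \<in> cells (mu C) n" "m < n" for x n m \<beta>
    using that unfolding mu_def mu_carrier_def
    by (cases \<beta>) (auto simp: mu_end_def z bz less_Suc_eq intro!: exI[of _ m])
  have I: "iter_idt (mu C) m k x = x" for m k x
    by (induction k) (auto simp: mu_def)
  have eqn: "\<forall>j \<alpha>. (j < m \<longrightarrow> y j \<alpha> = x j \<alpha>)" "y m Neg = x m Pos" if "composable (mu C) n m y x" for n m y x
    using that unfolding composable_def mu_def mu_end_def
    by (auto simp: fun_eq_iff split: if_splits)
  have K: "comp (mu C) n m y x \<in> cells (mu C) n" if c: "composable (mu C) n m y x" for n m y x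
  proof -
    have xy: "x \<in> cells (mu C) n" "y \<in> cells (mu C) n" "m < n" using c by (auto simp: composable_def)
    have xm: "mu_end Pos m x \<in> cells (mu C) m" using E xy by blast
    from xy xm show ?thesis
      unfolding mu_def mu_carrier_def
      apply (clarsimp simp: ad di ba bm)
      by (rule exI[of _ n]) simp
  qed
  show ?thesis
  proof
    fix m n x assume "m < n" "x \<in> cells (mu C) n"
    then show "src (mu C) n m x \<in> cells (mu C) m" "tgt (mu C) n m x \<in> cells (mu C) m" 
      using E by (auto simp: mu_def)
    from mu_top_eq[OF \<open>x \<in> cells (mu C) n\<close> bz]
    show "comp (mu C) n m x (iter_idt (mu C) m (n - m) (src (mu C) n m x)) = x"
     "comp (mu C) n m (iter_idt (mu C) m (n - m) (tgt (mu C) n m x)) x = x"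
      unfolding I by (auto simp: mu_def mu_end_def fun_eq_iff)
  next
    fix k m n :: nat and x assume "k < m" "m < n" "x \<in> cells (mu C) n"
    then show "src (mu C) m k (src (mu C) n m x) = src (mu C) n k x"
     "src (mu C) m k (tgt (mu C) n m x) = src (mu C) n k x"
     "tgt (mu C) m k (src (mu C) n m x) = tgt (mu C) n k x"
     "tgt (mu C) m k (tgt (mu C) n m x) = tgt (mu C) n k x"
      by (auto simp: mu_def mu_end_def fun_eq_iff)
  next
    fix n x assume x: "x \<in> cells (mu C) n"
    then show "idt (mu C) (Suc n) x \<in> cells (mu C) (Suc n)" by (auto simp: mu_def)
    have "x n \<alpha> = x n \<beta>" for \<alpha> \<beta> using mu_top_eq[OF x bz] by (cases \<alpha>; cases \<beta>) auto
    then show "src (mu C) (Suc n) n (idt (mu C) (Suc n) x) = x" "tgt (mu C) (Suc n) n (idt (mu C) (Suc n) x) = x"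
      using x by (auto simp: mu_def mu_end_def fun_eq_iff)
  next
    fix n m y x assume c: "composable (mu C) n m y x"
    then show "comp (mu C) n m y x \<in> cells (mu C) n" by (rule K)
    show "src (mu C) n m (comp (mu C) n m y x) = src (mu C) n m x"
      "tgt (mu C) n m (comp (mu C) n m y x) = tgt (mu C) n m y"
      using eqn[OF c] by (auto simp: mu_def mu_end_def fun_eq_iff)
    show "idt (mu C) (Suc n) (comp (mu C) n m y x)
            = comp (mu C) (Suc n) m (idt (mu C) (Suc n) y) (idt (mu C) (Suc n) x)"
      by (auto simp: mu_def)
  next
    fix n m y x k assume "composable (mu C) n m y x" "m < k" "k < n"
    then show "src (mu C) n k (comp (mu C) n m y x) = comp (mu C) k m (src (mu C) n k y) (src (mu C) n k x)"
      "tgt (mu C) n k (comp (mu C) n m y x) = comp (mu C) k m (tgt (mu C) n k y) (tgt (mu C) n k x)"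
      by (auto simp: mu_def mu_end_def fun_eq_iff)
  next
    fix n m z y x assume c: "composable (mu C) n m z y" "composable (mu C) n m y x"
    show "comp (mu C) n m (comp (mu C) n m z y) x = comp (mu C) n m z (comp (mu C) n m y x)"
      using eqn[OF c(1)] eqn[OF c(2)] by (auto simp: mu_def mu_end_def fun_eq_iff)
  next
    fix k m n y' y x' x assume c: "k < m" "composable (mu C) n m y' y" "composable (mu C) n m x' x"
          "composable (mu C) n k y' x'" "composable (mu C) n k y x"
    show "comp (mu C) n k (comp (mu C) n m y' y) (comp (mu C) n m x' x)
            = comp (mu C) n m (comp (mu C) n k y' x') (comp (mu C) n k y x)"
      using eqn[OF c(2)] eqn[OF c(3)] eqn[OF c(4)] eqn[OF c(5)] c(1)
      by (auto simp: mu_def mu_end_def fun_eq_iff)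
  qed
qed


section \<open>Free modules and their tensor products\<close>

text \<open>
  The free \<open>R\<close>-module on a set of elements of type \<open>'b\<close> is modelled inside \<open>'b \<Rightarrow>\<^sub>0 'r\<close>.
  The tensor square of a free module with basis \<open>B\<close> is the free module on \<open>B \<times> B\<close>.
\<close>

definition scale :: "'r::comm_ring_1 \<Rightarrow> ('b \<Rightarrow>\<^sub>0 'r) \<Rightarrow> ('b \<Rightarrow>\<^sub>0 'r)" where
  "scale r = Poly_Mapping.map ((*) r)"

definition lin_ext :: "('a \<Rightarrow> ('b \<Rightarrow>\<^sub>0 'r)) \<Rightarrow> ('a \<Rightarrow>\<^sub>0 'r::comm_ring_1) \<Rightarrow> ('b \<Rightarrow>\<^sub>0 'r)" where
  "lin_ext f c = (\<Sum>a \<in> Poly_Mapping.keys c. scale (Poly_Mapping.lookup c a) (f a))"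

definition tensor ::
  "('a \<Rightarrow>\<^sub>0 'r::comm_ring_1) \<Rightarrow> ('b \<Rightarrow>\<^sub>0 'r) \<Rightarrow> (('a \<times> 'b) \<Rightarrow>\<^sub>0 'r)" where
  "tensor x y = (\<Sum>a \<in> Poly_Mapping.keys x. \<Sum>b \<in> Poly_Mapping.keys y.
     Poly_Mapping.single (a, b) (Poly_Mapping.lookup x a * Poly_Mapping.lookup y b))"

lemma lin_ext_single: "lin_ext f (Poly_Mapping.single x (1::'r::comm_ring_1)) = f x"
proof -
  have "scale (1::'r) v = v" for v :: "'z \<Rightarrow>\<^sub>0 'r"
    by (rule poly_mapping_eqI) (simp add: scale_def map.rep_eq when_def)
  then show ?thesis by (simp add: lin_ext_def)
qed


section \<open>Coalgebras with a basis and the construction \<open>\<xi>\<close>\<close>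

text \<open>
  The underlying module is free on the homogeneous basis \<open>basis C\<close>; a basis element \<open>b\<close> is the
  chain \<open>Poly_Mapping.single b 1\<close>, of degree \<open>deg C b\<close>.
\<close>

record (overloaded) ('b, 'r) based_coalgebra = "('b \<Rightarrow>\<^sub>0 'r::comm_ring_1) dg_module" +
  basis :: "'b set"
  deg :: "'b \<Rightarrow> nat"
  cop :: "nat \<Rightarrow> ('b \<Rightarrow>\<^sub>0 'r) \<Rightarrow> (('b \<times> 'b) \<Rightarrow>\<^sub>0 'r)"
  counit :: "('b \<Rightarrow>\<^sub>0 'r) \<Rightarrow> 'r"

definition group_like ::
  "('b, 'r::comm_ring_1, 'z) based_coalgebra_scheme \<Rightarrow> nat \<Rightarrow> ('b \<Rightarrow>\<^sub>0 'r) \<Rightarrow> bool" where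
  "group_like C m c \<longleftrightarrow> c \<in> component C m \<and>
     (\<forall>k. Poly_Mapping.keys (cop C k c)
        \<subseteq> {a \<in> basis C. deg C a \<le> m} \<times> {a \<in> basis C. deg C a \<le> m}) \<and>
     cop C m c = tensor c c \<and>
     (m = 0 \<longrightarrow> counit C c = 1)"

definition proj_pos :: "'b \<Rightarrow> (('b \<times> 'b) \<Rightarrow>\<^sub>0 'r::comm_ring_1) \<Rightarrow> ('b \<Rightarrow>\<^sub>0 'r)" where
  "proj_pos b = lin_ext (\<lambda>(x, y). if y = b then Poly_Mapping.single x 1 else 0)"

definition twist ::
  "('b, 'r::comm_ring_1, 'z) based_coalgebra_scheme \<Rightarrow>
     (('b \<times> 'b) \<Rightarrow>\<^sub>0 'r) \<Rightarrow> (('b \<times> 'b) \<Rightarrow>\<^sub>0 'r)" where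
  "twist C = lin_ext (\<lambda>(x, y). Poly_Mapping.single (y, x) ((-1) ^ (deg C x * deg C y)))"

definition proj_neg ::
  "('b, 'r::comm_ring_1, 'z) based_coalgebra_scheme \<Rightarrow> 'b \<Rightarrow>
     (('b \<times> 'b) \<Rightarrow>\<^sub>0 'r) \<Rightarrow> ('b \<Rightarrow>\<^sub>0 'r)" where
  "proj_neg C b t = proj_pos b (twist C t)"

fun atom ::
  "('b, 'r::comm_ring_1, 'z) based_coalgebra_scheme \<Rightarrow> 'b \<Rightarrow> ('b \<Rightarrow>\<^sub>0 'r) mu_seq" where
  "atom C b k Neg = scale ((-1) ^ k) (proj_neg C b (cop C k (Poly_Mapping.single b 1)))"
| "atom C b k Pos = proj_pos b (cop C k (Poly_Mapping.single b 1))"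

definition xi ::
  "('b, 'r::comm_ring_1, 'z) based_coalgebra_scheme \<Rightarrow> ('b \<Rightarrow>\<^sub>0 'r) mu_seq omega_data" where
  "xi C = sub_omega_generated (mu C) (\<lambda>m. atom C ` {b \<in> basis C. deg C b = m})"


section \<open>Simplicial sets and normalized chains\<close>

text \<open>
  All simplices lie in one type and are told apart by their dimension; \<open>face X i\<close> is \<open>d\<^sub>i\<close> and
  \<open>degen X i\<close> is \<open>s\<^sub>i\<close>, in every dimension.
\<close>

record 'x simplicial_data =
  simplices :: "'x set"
  dim :: "'x \<Rightarrow> nat"
  face :: "nat \<Rightarrow> 'x \<Rightarrow> 'x"
  degen :: "nat \<Rightarrow> 'x \<Rightarrow> 'x"

definition nondegenerate :: "'x simplicial_data \<Rightarrow> 'x set" where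
  "nondegenerate X =
     {x \<in> simplices X. \<not> (\<exists>y \<in> simplices X. \<exists>i \<le> dim X y. x = degen X i y)}"

text \<open>
  Normalized chains are free on the non-degenerate simplices, and \<open>chain_class X x\<close> is the class
  of the simplex \<open>x\<close> modulo degenerate ones.
\<close>

definition chain_class :: "'x simplicial_data \<Rightarrow> 'x \<Rightarrow> ('x \<Rightarrow>\<^sub>0 'r::comm_ring_1)" where
  "chain_class X x = (if x \<in> nondegenerate X then Poly_Mapping.single x 1 else 0)"

definition chain_bd :: "'x simplicial_data \<Rightarrow> ('x \<Rightarrow>\<^sub>0 'r::comm_ring_1) \<Rightarrow> ('x \<Rightarrow>\<^sub>0 'r)" where
  "chain_bd X = lin_ext (\<lambda>x. if dim X x = 0 then 0
     else (\<Sum>i\<le>dim X x. scale ((-1) ^ i) (chain_class X (face X i x))))"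

definition normalized_chains :: "'x simplicial_data \<Rightarrow> ('x \<Rightarrow>\<^sub>0 'r::comm_ring_1) dg_module" where
  "normalized_chains X = \<lparr>
     component = \<lambda>m. {c. Poly_Mapping.keys c \<subseteq> {x \<in> nondegenerate X. dim X x = m}},
     bd = chain_bd X\<rparr>"


section \<open>The Steenrod cup-\<open>i\<close> coalgebra\<close>

text \<open>The position of \<open>u\<close> in \<open>U\<close> counted from \<open>1\<close>: it is \<open>j\<close> for \<open>u = u\<^sub>j\<close>.\<close>

definition position :: "nat set \<Rightarrow> nat \<Rightarrow> nat" where
  "position U u = card {v \<in> U. v \<le> u}"

definition U_neg :: "nat set \<Rightarrow> nat set" where
  "U_neg U = {u \<in> U. u mod 2 \<noteq> position U u mod 2}"

definition U_pos :: "nat set \<Rightarrow> nat set" where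
  "U_pos U = {u \<in> U. u mod 2 = position U u mod 2}"

text \<open>The face map with the largest index is applied first.\<close>

definition faces :: "'x simplicial_data \<Rightarrow> nat set \<Rightarrow> 'x \<Rightarrow> 'x" where
  "faces X U x = foldr (face X) (sorted_list_of_set U) x"

text \<open>
  Writing the condition \<open>card U = m - i\<close> as \<open>card U + i = m\<close> makes the index set empty for \<open>i > m\<close>.
\<close>

definition cup_coproduct ::
  "'x simplicial_data \<Rightarrow> nat \<Rightarrow> ('x \<Rightarrow>\<^sub>0 bit) \<Rightarrow> (('x \<times> 'x) \<Rightarrow>\<^sub>0 bit)" where
  "cup_coproduct X i = lin_ext (\<lambda>x. \<Sum>U \<in> {U. U \<subseteq> {0..dim X x} \<and> card U + i = dim X x}.
     tensor (chain_class X (faces X (U_neg U) x)) (chain_class X (faces X (U_pos U) x)))"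

definition augmentation :: "'x simplicial_data \<Rightarrow> ('x \<Rightarrow>\<^sub>0 'r::comm_ring_1) \<Rightarrow> 'r" where
  "augmentation X c = (\<Sum>x \<in> Poly_Mapping.keys c.
     Poly_Mapping.lookup c x * (if dim X x = 0 then 1 else 0))"

definition steenrod_coalgebra :: "'x simplicial_data \<Rightarrow> ('x, bit) based_coalgebra" where
  "steenrod_coalgebra X = \<lparr>
     component = component (normalized_chains X),
     bd = bd (normalized_chains X),
     basis = nondegenerate X,
     deg = dim X,
     cop = cup_coproduct X,
     counit = augmentation X\<rparr>"


section \<open>The representable simplicial sets\<close>

text \<open>
  An order-preserving map \<open>[m] \<rightarrow> [n]\<close> is the list of its \<open>m + 1\<close> values; \<open>d\<^sub>i\<close> deletes the entry
  at index \<open>i\<close> and \<open>s\<^sub>i\<close> repeats it.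
\<close>

definition std_simplex :: "nat \<Rightarrow> nat list simplicial_data" where
  "std_simplex n = \<lparr>
     simplices = {xs. xs \<noteq> [] \<and> sorted xs \<and> set xs \<subseteq> {0..n}},
     dim = \<lambda>xs. length xs - 1,
     face = \<lambda>i xs. take i xs @ drop (Suc i) xs,
     degen = \<lambda>i xs. take (Suc i) xs @ drop i xs\<rparr>"

lemma nondegenerate_std_simplex: "nondegenerate (std_simplex n) = {xs. xs \<noteq> [] \<and> sorted xs \<and> distinct xs \<and> set xs \<subseteq> {0..n}}"
proof -
  have A: "\<not> distinct (take (Suc i) y @ drop i y)" if "i \<le> length y - 1" "y \<noteq> []" for i and y :: "nat list"
  proof -
    have "i < length y" using that by (cases y) auto
    then have "y ! i \<in> set (take (Suc i) y)" "y ! i \<in> set (drop i y)"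
       by (auto simp: take_Suc_conv_app_nth Cons_nth_drop_Suc[symmetric])
    then show ?thesis by (metis disjoint_iff distinct_append)
  qed
  have B: "\<exists>y. y \<noteq> [] \<and> sorted y \<and> set y \<subseteq> {0..n} \<and> (\<exists>i \<le> length y - 1. x = take (Suc i) y @ drop i y)"
    if x: "sorted x" "\<not> distinct x" "set x \<subseteq> {0..n}" for x
  proof -
    have "\<not> sorted_wrt (<) x" using x strict_sorted_iff by blast
    then obtain i where i: "Suc i < length x" "\<not> x ! i < x ! Suc i"
      by (auto simp: sorted_wrt_iff_nth_Suc_transp)
    have e: "x ! i = x ! Suc i" using i x(1) by (metis le_neq_implies_less lessI less_imp_le_nat sorted_nth_mono)
    let ?y = "take (Suc i) x @ drop (Suc (Suc i)) x"
    have "x = take (Suc i) x @ x ! Suc i # drop (Suc (Suc i)) x" using i by (metis id_take_nth_drop)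
    then have "sorted (take (Suc i) x @ x ! Suc i # drop (Suc (Suc i)) x)" using x(1) by simp
    then have 1: "sorted ?y" unfolding sorted_append by simp
    have 2: "take (Suc i) ?y = take (Suc i) x" using i by simp
    have 3: "drop i ?y = x ! i # drop (Suc (Suc i)) x" using i by (simp add: take_Suc_conv_app_nth)
    have "x = take (Suc i) ?y @ drop i ?y" unfolding 2 3 e using i by (metis id_take_nth_drop)
    moreover have "set ?y \<subseteq> {0..n}" using x(3) by (auto dest: in_set_takeD in_set_dropD)
    ultimately show ?thesis using 1 i by (intro exI[of _ ?y]) (auto intro!: exI[of _ i])
  qed
  show ?thesis unfolding nondegenerate_def std_simplex_def using A B by (auto; blast)
qed

lemma nondegenerate_group_like:
  assumes "b \<in> nondegenerate (std_simplex n)"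
  shows "group_like (steenrod_coalgebra (std_simplex n)) (dim (std_simplex n) b) (Poly_Mapping.single b 1)"
proof -
  let ?X = "std_simplex n"
  have 1: "chain_class ?X b = Poly_Mapping.single b (1::bit)" using assms by (simp add: chain_class_def)
  have len: "dim ?X (foldr (face ?X) us x) \<le> dim ?X x" for us x
    by (induction us) (auto simp: std_simplex_def)
  have kc: "Poly_Mapping.keys (chain_class ?X (faces ?X U b) :: _ \<Rightarrow>\<^sub>0 bit) \<subseteq> {a \<in> nondegenerate ?X. dim ?X a \<le> dim ?X b}" for U
    using len by (auto simp: chain_class_def faces_def)
  have kt: "Poly_Mapping.keys (tensor x y) \<subseteq> Poly_Mapping.keys x \<times> Poly_Mapping.keys y" for x y :: "nat list \<Rightarrow>\<^sub>0 bit"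
    unfolding tensor_def
    by (intro order.trans[OF keys_sum] UN_least) (auto split: if_splits)
  have e: "{U. U \<subseteq> {0..dim ?X b} \<and> card U = 0} = {{}}"
    by (auto dest: finite_subset)
  show ?thesis
    unfolding group_like_def steenrod_coalgebra_def
    apply (simp add: cup_coproduct_def lin_ext_single normalized_chains_def assms augmentation_def e 1 U_pos_def U_neg_def faces_def)
    apply (intro allI order.trans[OF keys_sum] UN_least order.trans[OF kt])
    using kc by (fastforce simp: U_pos_def U_neg_def faces_def)
qed


section \<open>Orientals\<close>

fun signed_part :: "polarity \<Rightarrow> ('b \<Rightarrow>\<^sub>0 int) \<Rightarrow> ('b \<Rightarrow>\<^sub>0 int)" where
  "signed_part Pos c = Poly_Mapping.map (\<lambda>a. max a 0) c"
| "signed_part Neg c = Poly_Mapping.map (\<lambda>a. max (- a) 0) c"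

definition steiner_atom :: "'x simplicial_data \<Rightarrow> 'x \<Rightarrow> ('x \<Rightarrow>\<^sub>0 int) mu_seq" where
  "steiner_atom X b k \<alpha> =
     (if k > dim X b then 0
      else ((\<lambda>c. signed_part \<alpha> (chain_bd X c)) ^^ (dim X b - k)) (Poly_Mapping.single b 1))"

definition oriental :: "nat \<Rightarrow> (nat list \<Rightarrow>\<^sub>0 int) mu_seq omega_data" where
  "oriental n = sub_omega_generated (mu (normalized_chains (std_simplex n)))
     (\<lambda>m. steiner_atom (std_simplex n)
            ` {b \<in> nondegenerate (std_simplex n). dim (std_simplex n) b = m})"

definition reduce_mod_2 :: "('b \<Rightarrow>\<^sub>0 int) \<Rightarrow> ('b \<Rightarrow>\<^sub>0 bit)" where
  "reduce_mod_2 = Poly_Mapping.map of_int"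

end

theory Submission
  imports Defs
begin

text \<open>
  A non-degenerate simplex of \<open>\<Delta>\<^sup>n\<close> is a set of vertices.  Both kinds of atoms have the same
  description over any coefficient ring.  A face \<open>C\<close> of a simplex \<open>B\<close> splits the remaining vertices
  \<open>B - C\<close> into gaps: a vertex \<open>v\<close> lies in the gap numbered by how many vertices of \<open>C\<close> are below it.
  The component of degree \<open>k\<close> and sign \<open>+\<close> (resp. \<open>-\<close>) of the atom of \<open>B\<close> is the sum of the
  \<open>k\<close>-dimensional faces \<open>C\<close> for which all vertices of \<open>B - C\<close> lie in even (resp. odd) gaps.

  For Steiner's atoms this is a telescoping argument: in the boundary of such a sum the coefficient
  of a face \<open>C\<close> is an alternating sum over \<open>B - C\<close> that collapses to \<open>1\<close> if all gaps are even,
  to \<open>-1\<close> if all are odd and to \<open>0\<close> otherwise (\<open>alternating_sign_sum\<close>, \<open>bd_gap_chain\<close>).  For the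
  cup-\<open>i\<close> coalgebra, \<open>\<pi>\<^sub>b\<close> singles out the terms of the coproduct with \<open>U\<^sup>+ = \<emptyset>\<close> or
  \<open>U\<^sup>- = \<emptyset>\<close>, and the parity condition defining \<open>U\<^sup>\<plusminus>\<close> is the parity of the gap
  (\<open>steenrod_atom_gap_chain\<close>).  So reduction modulo \<open>2\<close> takes atoms to atoms.

  What remains is that reduction is injective on the cells of the oriental.  Injectivity also gives
  surjectivity: two cells are composable as soon as their reductions are, so every composite
  of reduced atoms lifts (\<open>omega_iso_generated\<close>).  Injectivity holds because all coefficients of a cell
  of the oriental are \<open>0\<close> or \<open>1\<close>.  They are non-negative and the degree \<open>0\<close> parts have
  augmentation \<open>1\<close>, since this is true of atoms and stable under all operations; and these two
  properties bound the coefficients by \<open>1\<close> (\<open>cell_coefficient_le_1\<close>), by induction on \<open>n\<close>.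
  The coefficient of a simplex without the last vertex does not decrease when the last two vertices are
  identified, and this leaves a cell on one vertex fewer.  The coefficient of a simplex with the last
  vertex is read off from the link of that vertex, which is again such a cell up to a shift of degree.
\<close>

section \<open>Simplices as vertex sets\<close>

definition below :: "nat set \<Rightarrow> nat \<Rightarrow> nat" where
  "below C v = card {w \<in> C. w < v}"

abbreviation simplex :: "nat set \<Rightarrow> nat list" where
  "simplex \<equiv> sorted_list_of_set"

lemma below_insert:
  assumes "finite C" "u \<notin> C"
  shows "below (insert u C) v = below C v + of_bool (u < v)"
proof -
  have "{w \<in> insert u C. w < v} = (if u < v then insert u {w \<in> C. w < v} else {w \<in> C. w < v})"
    by auto
  then show ?thesis using assms by (auto simp: below_def)
qed

lemma below_above: "(\<And>w. w \<in> C \<Longrightarrow> w < v) \<Longrightarrow> below C v = card C"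
  unfolding below_def by (rule arg_cong[where f = card]) auto

lemma simplex_eqI:
  assumes "sorted xs" "distinct xs"
  shows "simplex (set xs) = xs"
  using assms by (simp add: sorted_list_of_set.idem_if_sorted_distinct)

lemma simplex_inj: "finite C \<Longrightarrow> finite D \<Longrightarrow> simplex C = simplex D \<longleftrightarrow> C = D"
  by (metis set_sorted_list_of_set)

lemma nondeg_simplex:
  "{x \<in> nondegenerate (std_simplex n). dim (std_simplex n) x = k}
    = simplex ` {C. C \<subseteq> {0..n} \<and> card C = Suc k}" (is "?L = ?R")
proof
  show "?L \<subseteq> ?R"
  proof
    fix x assume "x \<in> ?L"
    then have x: "x \<noteq> []" "sorted x" "distinct x" "set x \<subseteq> {0..n}" "length x - 1 = k"
      unfolding nondegenerate_std_simplex by (auto simp: std_simplex_def)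
    then have "length x = Suc k" by (cases x) auto
    then have "card (set x) = Suc k" by (simp add: distinct_card[OF x(3)])
    then show "x \<in> ?R" using x simplex_eqI[of x] by (intro image_eqI[of _ _ "set x"]) auto
  qed
  show "?R \<subseteq> ?L"
  proof
    fix x assume "x \<in> ?R"
    then obtain C where C: "x = simplex C" "C \<subseteq> {0..n}" "card C = Suc k" by auto
    then have "finite C" "C \<noteq> {}" using finite_subset by auto
    then show "x \<in> ?L" using C unfolding nondegenerate_std_simplex
      by (auto simp: std_simplex_def)
  qed
qed

lemma component_std_simplex:
  "component (normalized_chains (std_simplex n)) k
    = {c. Poly_Mapping.keys c \<subseteq> simplex ` {C. C \<subseteq> {0..n} \<and> card C = Suc k}}"
  by (simp add: normalized_chains_def nondeg_simplex)

lemma chain_eqI: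
  assumes "c \<in> component (normalized_chains (std_simplex n)) k"
    "d \<in> component (normalized_chains (std_simplex n)) k"
    and "\<And>C. C \<subseteq> {0..n} \<Longrightarrow> card C = Suc k \<Longrightarrow>
      Poly_Mapping.lookup c (simplex C) = Poly_Mapping.lookup d (simplex C)"
  shows "c = d"
proof (rule poly_mapping_eqI)
  fix x
  show "Poly_Mapping.lookup c x = Poly_Mapping.lookup d x"
  proof (cases "x \<in> simplex ` {C. C \<subseteq> {0..n} \<and> card C = Suc k}")
    case True then show ?thesis using assms(3) by auto
  next
    case False
    then have "x \<notin> Poly_Mapping.keys c" "x \<notin> Poly_Mapping.keys d"
      using assms(1,2) unfolding component_std_simplex by auto
    then show ?thesis by (simp add: in_keys_iff)
  qed
qed


section \<open>Linear extension and the boundary of chains\<close>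

lemma lookup_scale: "Poly_Mapping.lookup (scale r c) x = r * Poly_Mapping.lookup c x"
  by (simp add: scale_def map.rep_eq when_def)

lemma lookup_lin_ext:
  assumes "finite A" "Poly_Mapping.keys c \<subseteq> A"
  shows "Poly_Mapping.lookup (lin_ext f c) y
    = (\<Sum>a\<in>A. Poly_Mapping.lookup c a * Poly_Mapping.lookup (f a) y)"
proof -
  have "Poly_Mapping.lookup (lin_ext f c) y
    = (\<Sum>a\<in>Poly_Mapping.keys c. Poly_Mapping.lookup c a * Poly_Mapping.lookup (f a) y)"
    by (simp add: lin_ext_def lookup_sum lookup_scale)
  also have "\<dots> = (\<Sum>a\<in>A. Poly_Mapping.lookup c a * Poly_Mapping.lookup (f a) y)"
    using assms by (intro sum.mono_neutral_left) (auto simp: in_keys_iff)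
  finally show ?thesis .
qed

lemma lin_ext_zero: "lin_ext f 0 = 0"
  by (simp add: lin_ext_def)

lemma lin_ext_add: "lin_ext f (c + d) = lin_ext f c + lin_ext f d"
proof (rule poly_mapping_eqI)
  fix y
  let ?A = "Poly_Mapping.keys c \<union> Poly_Mapping.keys d"
  have "Poly_Mapping.keys (c + d) \<subseteq> ?A" by (rule keys_add)
  then show "Poly_Mapping.lookup (lin_ext f (c + d)) y = Poly_Mapping.lookup (lin_ext f c + lin_ext f d) y"
    by (simp add: lookup_add lookup_lin_ext[of ?A] sum.distrib distrib_right)
qed

lemma lin_ext_diff: "lin_ext f (c - d) = lin_ext f c - lin_ext f d"
  by (metis lin_ext_add diff_add_cancel add_diff_cancel)

lemma lin_ext_sum: "lin_ext f (\<Sum>i\<in>I. c i) = (\<Sum>i\<in>I. lin_ext f (c i))"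
  by (induction I rule: infinite_finite_induct) (simp_all add: lin_ext_zero lin_ext_add)

lemma face_simplex:
  assumes "finite C" "v \<notin> C"
  shows "simplex (insert v C) ! below C v = v"
    and "face (std_simplex n) (below C v) (simplex (insert v C)) = simplex C"
proof -
  define a where "a = simplex {w \<in> C. w < v}"
  define r where "r = simplex {w \<in> C. v < w}"
  have fin: "finite {w \<in> C. w < v}" "finite {w \<in> C. v < w}" using assms by auto
  have sets: "insert v C = set (a @ v # r)" "C = set (a @ r)"
    using fin assms by (auto simp: a_def r_def not_less le_less)
  have 1: "simplex (insert v C) = a @ v # r" unfolding sets(1)
    by (rule simplex_eqI) (use fin in \<open>auto simp: a_def r_def sorted_append\<close>)
  have 2: "simplex C = a @ r" unfolding sets(2)
    by (rule simplex_eqI) (use fin in \<open>auto simp: a_def r_def sorted_append\<close>)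
  have 3: "below C v = length a" by (simp add: a_def below_def)
  show "simplex (insert v C) ! below C v = v"
    "face (std_simplex n) (below C v) (simplex (insert v C)) = simplex C"
    unfolding 1 2 3 by (simp_all add: std_simplex_def)
qed

lemma below_nth:
  assumes "finite B" "i < card B"
  shows "below B (simplex B ! i) = i"
proof -
  let ?l = "simplex B"
  have l: "length ?l = card B" "set ?l = B" using assms by auto
  have "{w \<in> B. w < ?l ! i} = (!) ?l ` {..<i}"
  proof (intro set_eqI iffI)
    fix w assume w: "w \<in> {w \<in> B. w < ?l ! i}"
    then have "w \<in> set ?l" using l(2) by blast
    then obtain j where j: "j < card B" "w = ?l ! j"
      unfolding in_set_conv_nth l(1) by blast
    have "\<not> i \<le> j"
      using w j sorted_nth_mono[of ?l i j] l(1) by auto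
    then show "w \<in> (!) ?l ` {..<i}" using j by auto
  next
    fix w assume "w \<in> (!) ?l ` {..<i}"
    then obtain j where j: "j < i" "w = ?l ! j" by auto
    then have "?l ! j < ?l ! i"
      using l assms strict_sorted_list_of_set[of B] by (simp add: sorted_wrt_nth_less)
    moreover have "?l ! j \<in> B" using nth_mem[of j ?l] j assms(2) unfolding l by simp
    ultimately show "w \<in> {w \<in> B. w < ?l ! i}" using j by simp
  qed
  moreover have "inj_on ((!) ?l) {..<i}"
    using l assms by (intro inj_on_nth) auto
  ultimately show ?thesis unfolding below_def by (simp add: card_image)
qed

lemma face_nth_simplex:
  assumes "finite B" "i < card B"
  shows "face (std_simplex n) i (simplex B) = simplex (B - {simplex B ! i})"
proof -
  let ?v = "simplex B ! i"
  have "?v \<in> B" using assms by (metis nth_mem set_sorted_list_of_set length_sorted_list_of_set)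
  then have i: "insert ?v (B - {?v}) = B" by auto
  have "below (B - {?v}) ?v = below B ?v" unfolding below_def by (rule arg_cong[where f=card]) auto
  then show ?thesis
    using face_simplex(2)[of "B - {?v}" ?v n] assms below_nth[OF assms] unfolding i by simp
qed

text \<open>
  Deleting \<open>v\<close> from the simplex on \<open>insert v C\<close> is the face map whose index is the number of
  vertices of \<open>C\<close> below \<open>v\<close>, which gives the signs.
\<close>

lemma lookup_chain_bd:
  fixes f :: "nat list \<Rightarrow>\<^sub>0 'r::comm_ring_1"
  assumes f: "f \<in> component (normalized_chains (std_simplex n)) (Suc k)"
    and C: "C \<subseteq> {0..n}" "card C = Suc k"
  shows "Poly_Mapping.lookup (chain_bd (std_simplex n) f) (simplex C)
    = (\<Sum>v\<in>{0..n} - C. (-1) ^ below C v * Poly_Mapping.lookup f (simplex (insert v C)))"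
proof -
  let ?X = "std_simplex n"
  let ?B = "{B. B \<subseteq> {0..n} \<and> card B = Suc (Suc k)}"
  have finC: "finite C" using C finite_subset by blast
  have fin: "finite ?B" by (rule finite_subset[of _ "Pow {0..n}"]) auto
  have finB: "finite B" if "B \<subseteq> {0..n}" for B using that finite_subset by blast
  have inj: "inj_on simplex ?B" by (rule inj_onI) (use finB simplex_inj in auto)
  have face_in: "face ?X i (simplex B) \<in> nondegenerate ?X" if "B \<in> ?B" "i \<le> Suc k" for B i
  proof -
    have "finite B" using that finB by blast
    then have "simplex B ! i \<in> B" using that by (metis (mono_tags, lifting) le_imp_less_Suc length_sorted_list_of_set mem_Collect_eq nth_mem set_sorted_list_of_set)
    then have "B - {simplex B ! i} \<subseteq> {0..n} \<and> card (B - {simplex B ! i}) = Suc k" using that \<open>finite B\<close> by auto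
    then show ?thesis using that \<open>finite B\<close> face_nth_simplex[of B i n] nondeg_simplex[of n k] by auto
  qed
  have dimB: "dim ?X (simplex B) = Suc k" if "B \<in> ?B" for B using that by (simp add: std_simplex_def)
  have bdB: "Poly_Mapping.lookup (\<Sum>i\<le>dim ?X (simplex B). scale ((-1) ^ i) (chain_class ?X (face ?X i (simplex B)) :: _ \<Rightarrow>\<^sub>0 'r)) (simplex C)
     = (\<Sum>i\<le>Suc k. if face ?X i (simplex B) = simplex C then (-1) ^ i else 0)" if "B \<in> ?B" for B
    unfolding dimB[OF that] lookup_sum lookup_scale
    by (rule sum.cong) (use face_in[OF that] in \<open>auto simp: chain_class_def lookup_single when_def\<close>)
  have "Poly_Mapping.lookup (chain_bd ?X f) (simplex C)
     = (\<Sum>B\<in>?B. Poly_Mapping.lookup f (simplex B) *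
         (\<Sum>i\<le>Suc k. if face ?X i (simplex B) = simplex C then (-1) ^ i else 0))"
    unfolding chain_bd_def
    apply (subst lookup_lin_ext[of "simplex ` ?B"])
    subgoal using fin by simp
    subgoal using f unfolding component_std_simplex by simp
    apply (subst sum.reindex[OF inj])
    apply (rule sum.cong)
    using bdB dimB by (auto simp del: sum.atMost_Suc)
  also have "\<dots> = (\<Sum>p\<in>?B \<times> {..Suc k}. if face ?X (snd p) (simplex (fst p)) = simplex C
         then (-1) ^ snd p * Poly_Mapping.lookup f (simplex (fst p)) else 0)"
    unfolding sum_distrib_left sum.cartesian_product
    by (rule sum.cong) (auto simp: mult.commute)
  also have "\<dots> = (\<Sum>p\<in>{p \<in> ?B \<times> {..Suc k}. face ?X (snd p) (simplex (fst p)) = simplex C}.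
         (-1) ^ snd p * Poly_Mapping.lookup f (simplex (fst p)))"
    using fin by (intro sum.inter_filter[symmetric]) auto
  also have "\<dots> = (\<Sum>v\<in>{0..n} - C. (-1) ^ below C v * Poly_Mapping.lookup f (simplex (insert v C)))"
  proof (rule sum.reindex_bij_witness[where i = "\<lambda>v. (insert v C, below C v)" and j = "\<lambda>p. simplex (fst p) ! snd p"])
    fix v assume v: "v \<in> {0..n} - C"
    have "below C v \<le> card C" unfolding below_def using finC by (intro card_mono) auto
    then show "(insert v C, below C v) \<in> {p \<in> ?B \<times> {..Suc k}. face ?X (snd p) (simplex (fst p)) = simplex C}"
      using v C finC face_simplex(2)[of C v n] by auto
    show "simplex (fst (insert v C, below C v)) ! snd (insert v C, below C v) = v"
      using face_simplex(1)[of C v] v finC by simp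
  next
    fix p assume "p \<in> {p \<in> ?B \<times> {..Suc k}. face ?X (snd p) (simplex (fst p)) = simplex C}"
    then obtain B i where p: "p = (B, i)" "B \<in> ?B" "i \<le> Suc k" "face ?X i (simplex B) = simplex C"
      by (cases p) auto
    have fB: "finite B" using p finB by blast
    have i: "i < card B" using p by auto
    let ?v = "simplex B ! i"
    have vB: "?v \<in> B" using i fB by (metis length_sorted_list_of_set nth_mem set_sorted_list_of_set)
    have "simplex (B - {?v}) = simplex C" using p face_nth_simplex[OF fB i, of n] by simp
    then have C': "C = B - {?v}" using simplex_inj fB finC by auto
    have "below C ?v = below B ?v" unfolding below_def C' by (rule arg_cong[where f=card]) auto
    then have b: "below C ?v = i" using below_nth[OF fB i] by simp
    have ins: "insert ?v C = B" using C' vB by auto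
    show "(insert (simplex (fst p) ! snd p) C, below C (simplex (fst p) ! snd p)) = p"
      "simplex (fst p) ! snd p \<in> {0..n} - C"
      "(-1) ^ below C (simplex (fst p) ! snd p) * Poly_Mapping.lookup f (simplex (insert (simplex (fst p) ! snd p) C))
        = (-1) ^ snd p * Poly_Mapping.lookup f (simplex (fst p))"
      using b ins p vB C' by auto
  qed
  finally show ?thesis .
qed

lemma chain_bd_component:
  fixes f :: "nat list \<Rightarrow>\<^sub>0 'r::comm_ring_1"
  assumes f: "f \<in> component (normalized_chains (std_simplex n)) (Suc k)"
  shows "chain_bd (std_simplex n) f \<in> component (normalized_chains (std_simplex n)) k"
proof -
  let ?X = "std_simplex n"
  have "Poly_Mapping.lookup (chain_bd ?X f) y = 0" if y: "y \<notin> {x \<in> nondegenerate ?X. dim ?X x = k}" for y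
  proof -
    have "Poly_Mapping.lookup (scale r (chain_class ?X (face ?X i x) :: _ \<Rightarrow>\<^sub>0 'r)) y = 0"
      if "x \<in> Poly_Mapping.keys f" "i \<le> dim ?X x" for x i r
    proof -
      have "dim ?X x = Suc k" using f that by (auto simp: normalized_chains_def)
      then have "dim ?X (face ?X i x) = k" using that(2) by (auto simp: std_simplex_def)
      then show ?thesis using y by (auto simp: lookup_scale chain_class_def lookup_single when_def)
    qed
    then show ?thesis unfolding chain_bd_def
      by (subst lookup_lin_ext[OF finite_keys subset_refl]) (auto simp: lookup_sum intro!: sum.neutral)
  qed
  then show ?thesis by (auto simp: normalized_chains_def in_keys_iff)
qed

section \<open>Coefficients of cells\<close>

text \<open>
  The function \<open>x k \<alpha>\<close> gives the coefficients of the components \<open>c\<^sub>k\<^sup>\<plusminus>\<close> of an element of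
  \<open>\<mu>(C(\<Delta>\<^sup>n; \<int>))\<close>, indexed by vertex sets.  The two induction steps, collapse and link, are
  compatible with the boundary and preserve non-negativity and the total weight \<open>1\<close> in degree \<open>0\<close>.
\<close>

lemma cell_coefficient_le_1:
  fixes x :: "nat \<Rightarrow> polarity \<Rightarrow> nat set \<Rightarrow> int"
  assumes bd: "\<And>k \<alpha> C. C \<subseteq> {0..n} \<Longrightarrow> card C = Suc k \<Longrightarrow>
      x k Pos C - x k Neg C = (\<Sum>v\<in>{0..n} - C. (-1) ^ below C v * x (Suc k) \<alpha> (insert v C))"
    and nonneg: "\<And>k \<alpha> C. 0 \<le> x k \<alpha> C"
    and unital: "\<And>\<alpha>. (\<Sum>v\<in>{0..n}. x 0 \<alpha> {v}) = 1"
    and "C \<subseteq> {0..n}" "card C = Suc k"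
  shows "x k \<alpha> C \<le> 1"
  using assms
proof (induction n arbitrary: x k \<alpha> C)
  case 0
  then have "C = {0}" by (auto simp: subset_singleton_iff)
  moreover have "k = 0" using 0 \<open>C = {0}\<close> by simp
  ultimately show ?case using "0.prems"(3)[of \<alpha>] by simp
next
  case (Suc n)
  let ?N = "Suc n"
  note bd = Suc.prems(1) and nonneg = Suc.prems(2) and unital = Suc.prems(3)
  have le0: "x 0 \<alpha> {v} \<le> 1" if "v \<le> ?N" for v \<alpha>
    using member_le_sum[of v "{0..?N}" "\<lambda>v. x 0 \<alpha> {v}"] nonneg unital that by simp
  have finC: "finite C" if "C \<subseteq> {0..n}" for C using that finite_subset by blast
  have sum_split: "(\<Sum>v\<in>{0..?N} - C. g v) = (\<Sum>v\<in>{0..n} - C. g v) + g ?N"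
    if "C \<subseteq> {0..n}" for C and g :: "nat \<Rightarrow> int"
  proof -
    have "{0..?N} - C = insert ?N ({0..n} - C)" using that by (auto simp: le_Suc_eq)
    then show ?thesis by simp
  qed
  show ?case
  proof (cases "?N \<in> C")
    case False
    \<comment> \<open>The image of the cell under the collapse identifying the last two vertices.\<close>
    define y where "y k \<alpha> C = x k \<alpha> C + (if n \<in> C then x k \<alpha> (insert ?N (C - {n})) else 0)" for k \<alpha> C
    have C: "C \<subseteq> {0..n}" using False Suc.prems(4) by (auto simp: subset_iff le_Suc_eq)
    have "y k \<alpha> C \<le> 1"
    proof (rule Suc.IH)
      fix k \<alpha> C assume C: "C \<subseteq> {0..n}" "card C = Suc k"
      have N: "?N \<notin> C" using C by auto
      show "y k Pos C - y k Neg C = (\<Sum>v\<in>{0..n} - C. (-1) ^ below C v * y (Suc k) \<alpha> (insert v C))"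
      proof (cases "n \<in> C")
        case False
        have same: "below C ?N = below C n" unfolding below_def
          by (rule arg_cong[where f=card]) (use False in \<open>auto simp: less_Suc_eq\<close>)
        have ins: "insert ?N (insert n C - {n}) = insert ?N C" using False by auto
        let ?E = "{0..n} - C - {n}"
        have *: "{0..n} - C = insert n ?E" using False by auto
        \<comment> \<open>The faces obtained by adding \<open>n\<close> and \<open>?N\<close> enter with equal signs and have the same image.\<close>
        have "y k Pos C - y k Neg C = x k Pos C - x k Neg C" using False by (simp add: y_def)
        also have "\<dots> = (\<Sum>v\<in>{0..?N} - C. (-1) ^ below C v * x (Suc k) \<alpha> (insert v C))"
          using C by (intro bd) auto
        also have "\<dots> = (\<Sum>v\<in>?E. (-1) ^ below C v * x (Suc k) \<alpha> (insert v C))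
             + (-1) ^ below C n * x (Suc k) \<alpha> (insert n C)
             + (-1) ^ below C n * x (Suc k) \<alpha> (insert ?N C)"
          unfolding sum_split[OF C(1)] same by (subst *, subst sum.insert) auto
        also have "\<dots> = (\<Sum>v\<in>?E. (-1) ^ below C v * y (Suc k) \<alpha> (insert v C))
             + (-1) ^ below C n * y (Suc k) \<alpha> (insert n C)"
        proof -
          have "y (Suc k) \<alpha> (insert v C) = x (Suc k) \<alpha> (insert v C)" if "v \<in> ?E" for v
            using that False by (auto simp: y_def)
          moreover have "y (Suc k) \<alpha> (insert n C) = x (Suc k) \<alpha> (insert n C) + x (Suc k) \<alpha> (insert ?N C)"
            unfolding y_def ins by simp
          ultimately show ?thesis by (simp add: algebra_simps)
        qed
        also have "\<dots> = (\<Sum>v\<in>{0..n} - C. (-1) ^ below C v * y (Suc k) \<alpha> (insert v C))"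
          by (subst (2) *, subst sum.insert) auto
        finally show ?thesis .
      next
        case True
        \<comment> \<open>\<open>C\<close> and \<open>?D\<close> have the same image; the simplex \<open>insert ?N C\<close>, which degenerates,
          enters their boundary coefficients with opposite signs.\<close>
        define E where "E = C - {n}"
        have E: "C = insert n E" "n \<notin> E" "E \<subseteq> {0..n}" "?N \<notin> E" using True C by (auto simp: E_def)
        have fE: "finite E" using E finC by blast
        let ?D = "insert ?N E"
        have cE: "card E = k" "card ?D = Suc k" using E C fE by auto
        have Dsub: "?D \<subseteq> {0..?N}" using E by auto
        have dom: "{0..?N} - ?D = insert n ({0..n} - C)" using E by (auto simp: le_Suc_eq)
        have small: "below C v = below E v" "below ?D v = below E v" if "v \<in> {0..n} - C" for v
          using that below_insert[OF fE, of n v] below_insert[OF fE, of ?N v] E by auto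
        have "below E n = k" unfolding cE(1)[symmetric]
          by (rule below_above) (use E in \<open>metis atLeastAtMost_iff le_neq_implies_less subsetD\<close>)
        then have Dn: "below ?D n = k" using below_insert[OF fE, of ?N n] E by simp
        have CN: "below C ?N = Suc k" unfolding C(2)[symmetric]
          by (rule below_above) (use C in auto)
        have insD: "insert n ?D = insert ?N C" using E by auto
        have "x k Pos C - x k Neg C = (\<Sum>v\<in>{0..n} - C. (-1) ^ below C v * x (Suc k) \<alpha> (insert v C))
            + (-1) ^ Suc k * x (Suc k) \<alpha> (insert ?N C)"
          using bd[of C k \<alpha>] C(2) order.trans[OF C(1), of "{0..?N}"] unfolding sum_split[OF C(1)] CN by auto
        moreover have "x k Pos ?D - x k Neg ?D = (-1) ^ k * x (Suc k) \<alpha> (insert ?N C)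
            + (\<Sum>v\<in>{0..n} - C. (-1) ^ below C v * x (Suc k) \<alpha> (insert v ?D))"
        proof -
          have "x k Pos ?D - x k Neg ?D = (\<Sum>v\<in>{0..?N} - ?D. (-1) ^ below ?D v * x (Suc k) \<alpha> (insert v ?D))"
            using cE Dsub by (intro bd) auto
          also have "\<dots> = (-1) ^ below ?D n * x (Suc k) \<alpha> (insert n ?D)
             + (\<Sum>v\<in>{0..n} - C. (-1) ^ below ?D v * x (Suc k) \<alpha> (insert v ?D))"
            unfolding dom by (rule sum.insert) (use E in auto)
          also have "(\<Sum>v\<in>{0..n} - C. (-1) ^ below ?D v * x (Suc k) \<alpha> (insert v ?D))
             = (\<Sum>v\<in>{0..n} - C. (-1) ^ below C v * x (Suc k) \<alpha> (insert v ?D))"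
            using small by (intro sum.cong) auto
          finally show ?thesis unfolding Dn insD .
        qed
        moreover have "y k \<alpha> C = x k \<alpha> C + x k \<alpha> ?D" for \<alpha> using True by (simp add: y_def E_def)
        moreover have "y (Suc k) \<alpha> (insert v C) = x (Suc k) \<alpha> (insert v C) + x (Suc k) \<alpha> (insert v ?D)"
          if "v \<in> {0..n} - C" for v
        proof -
          have "insert ?N (insert v C - {n}) = insert v ?D" using that E by auto
          then show ?thesis using True by (simp add: y_def)
        qed
        ultimately show ?thesis
          by (simp add: sum.distrib algebra_simps)
      qed
    next
      fix k \<alpha> C show "0 \<le> y k \<alpha> C" using nonneg by (simp add: y_def)
    next
      fix \<alpha>
      have "(\<Sum>v\<in>{0..n}. y 0 \<alpha> {v}) = (\<Sum>v\<in>{0..n}. x 0 \<alpha> {v} + (if v = n then x 0 \<alpha> {?N} else 0))"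
        by (rule sum.cong) (auto simp: y_def)
      also have "\<dots> = 1" using unital[of \<alpha>] by (simp add: sum.distrib)
      finally show "(\<Sum>v\<in>{0..n}. y 0 \<alpha> {v}) = 1" .
    qed (use C Suc.prems in auto)
    moreover have "x k \<alpha> C \<le> y k \<alpha> C" using nonneg by (simp add: y_def)
    ultimately show ?thesis by simp
  next
    case True
    define E where "E = C - {?N}"
    have E: "C = insert ?N E" "E \<subseteq> {0..n}" "?N \<notin> E"
      using True Suc.prems(4) by (auto simp: E_def le_Suc_eq)
    have cE: "card E = k" using Suc.prems(5) E finC[OF E(2)] by auto
    show ?thesis
    proof (cases k)
      case 0
      then have "C = {?N}" using cE E finC[OF E(2)] by auto
      then show ?thesis using le0 0 by simp
    next
      case (Suc l)
      \<comment> \<open>The link of the last vertex.  It has total weight \<open>x 0 Pos {?N} - x 0 Neg {?N}\<close>, which is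
        \<open>0\<close> or \<open>1\<close>; a multiple of the identity cell on vertex \<open>0\<close> makes up for the deficit.\<close>
      define \<delta> where "\<delta> = 1 - (x 0 Pos {?N} - x 0 Neg {?N})"
      define z where "z k \<alpha> E = x (Suc k) \<alpha> (insert ?N E) + (if k = 0 \<and> E = {0} then \<delta> else 0)" for k \<alpha> E
      have \<delta>: "0 \<le> \<delta>" using le0[of ?N Pos] nonneg[of 0 Neg "{?N}"] by (simp add: \<delta>_def)
      have "z l \<alpha> E \<le> 1"
      proof (rule Suc.IH)
        fix k \<alpha> E assume E: "E \<subseteq> {0..n}" "card E = Suc k"
        let ?D = "insert ?N E"
        have N: "?N \<notin> E" using E by auto
        have dom: "{0..?N} - ?D = {0..n} - E" by (auto simp: le_Suc_eq)
        have "z k Pos E - z k Neg E = x (Suc k) Pos ?D - x (Suc k) Neg ?D" by (simp add: z_def)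
        also have "\<dots> = (\<Sum>v\<in>{0..n} - E. (-1) ^ below ?D v * x (Suc (Suc k)) \<alpha> (insert v ?D))"
          unfolding dom[symmetric] by (rule bd) (use E N finC[OF E(1)] in auto)
        also have "\<dots> = (\<Sum>v\<in>{0..n} - E. (-1) ^ below E v * z (Suc k) \<alpha> (insert v E))"
        proof (rule sum.cong[OF refl])
          fix v assume "v \<in> {0..n} - E"
          then have "below ?D v = below E v" using below_insert[OF finC[OF E(1)] N, of v] by auto
          then show "(-1) ^ below ?D v * x (Suc (Suc k)) \<alpha> (insert v ?D) = (-1) ^ below E v * z (Suc k) \<alpha> (insert v E)"
            by (simp add: z_def insert_commute)
        qed
        finally show "z k Pos E - z k Neg E = (\<Sum>v\<in>{0..n} - E. (-1) ^ below E v * z (Suc k) \<alpha> (insert v E))" .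
      next
        fix k \<alpha> E show "0 \<le> z k \<alpha> E" using nonneg \<delta> by (simp add: z_def)
      next
        fix \<alpha>
        have dom: "{0..?N} - {?N} = {0..n}" by auto
        have "x 0 Pos {?N} - x 0 Neg {?N} = (\<Sum>v\<in>{0..?N} - {?N}. (-1) ^ below {?N} v * x (Suc 0) \<alpha> (insert v {?N}))"
          by (rule bd) auto
        also have "\<dots> = (\<Sum>v\<in>{0..n}. x (Suc 0) \<alpha> (insert ?N {v}))"
          unfolding dom using below_insert[of "{}" ?N]
          by (intro sum.cong) (auto simp: below_def insert_commute)
        finally have "(\<Sum>v\<in>{0..n}. x (Suc 0) \<alpha> (insert ?N {v})) = 1 - \<delta>" by (simp add: \<delta>_def)
        moreover have "(\<Sum>v\<in>{0..n}. z 0 \<alpha> {v}) = (\<Sum>v\<in>{0..n}. x (Suc 0) \<alpha> (insert ?N {v}) + (if v = 0 then \<delta> else 0))"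
          by (rule sum.cong) (auto simp: z_def)
        ultimately show "(\<Sum>v\<in>{0..n}. z 0 \<alpha> {v}) = 1" by (simp add: sum.distrib)
      qed (use E cE Suc in auto)
      then show ?thesis using \<delta> E Suc by (simp add: z_def split: if_splits)
    qed
  qed
qed

section \<open>Gap subsets and the atoms of the orientals\<close>

text \<open>
  In the notation of the face operators, \<open>C\<close> is \<open>d\<^sub>U B\<close> for the set \<open>U\<close> of positions of
  \<open>B - C\<close>, and the condition for \<open>Pos\<close> says \<open>u\<^sub>j \<equiv> j - 1\<close> modulo \<open>2\<close> for all \<open>j\<close>: the number of
  kept positions before \<open>u\<^sub>j\<close> is \<open>u\<^sub>j - (j - 1)\<close>.
\<close>

definition gap_subsets :: "polarity \<Rightarrow> nat set \<Rightarrow> nat \<Rightarrow> nat set set" where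
  "gap_subsets \<alpha> B k =
     {C. C \<subseteq> B \<and> card C = Suc k \<and> (\<forall>v \<in> B - C. even (below C v) \<longleftrightarrow> \<alpha> = Pos)}"

definition gap_chain :: "polarity \<Rightarrow> nat set \<Rightarrow> nat \<Rightarrow> (nat list \<Rightarrow>\<^sub>0 'r::comm_ring_1)" where
  "gap_chain \<alpha> B k = (\<Sum>C\<in>gap_subsets \<alpha> B k. Poly_Mapping.single (simplex C) 1)"

lemma gap_subsets_finite: "finite B \<Longrightarrow> finite (gap_subsets \<alpha> B k)"
  by (rule finite_subset[of _ "Pow B"]) (auto simp: gap_subsets_def)

lemma lookup_gap_chain:
  assumes "finite B" "finite C"
  shows "Poly_Mapping.lookup (gap_chain \<alpha> B k) (simplex C)
    = (of_bool (C \<in> gap_subsets \<alpha> B k) :: 'r::comm_ring_1)"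
proof -
  have "Poly_Mapping.lookup (gap_chain \<alpha> B k) (simplex C)
      = (\<Sum>D\<in>gap_subsets \<alpha> B k. if D = C then 1 else (0::'r))"
    unfolding gap_chain_def lookup_sum
  proof (rule sum.cong[OF refl])
    fix D assume "D \<in> gap_subsets \<alpha> B k"
    then have "finite D" using assms(1) finite_subset by (auto simp: gap_subsets_def)
    then show "Poly_Mapping.lookup (Poly_Mapping.single (simplex D) (1::'r)) (simplex C) = (if D = C then 1 else 0)"
      using assms(2) by (simp add: lookup_single when_def simplex_inj)
  qed
  also have "\<dots> = of_bool (C \<in> gap_subsets \<alpha> B k)"
    using gap_subsets_finite[OF assms(1)] by simp
  finally show ?thesis .
qed

lemma keys_gap_chain:
  "Poly_Mapping.keys (gap_chain \<alpha> B k) \<subseteq> simplex ` gap_subsets \<alpha> B k"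
  unfolding gap_chain_def by (intro order.trans[OF keys_sum]) auto

lemma gap_chain_component:
  assumes "B \<subseteq> {0..n}"
  shows "(gap_chain \<alpha> B k :: nat list \<Rightarrow>\<^sub>0 'r::comm_ring_1) \<in> component (normalized_chains (std_simplex n)) k"
  using keys_gap_chain[of \<alpha> B k] assms unfolding component_std_simplex
  by (fastforce simp: gap_subsets_def)

text \<open>
  The summand of \<open>v\<close> is non-zero only if the parities along \<open>D\<close> read even up to \<open>v\<close> and odd from
  there on, \<open>v\<close> itself being of either parity.  If both parities occur in this order there
  are two such \<open>v\<close>, the last even one and the first odd one, and their signs cancel.
\<close>

lemma alternating_sign_sum:
  fixes p :: "nat \<Rightarrow> nat"
  assumes "finite D" "D \<noteq> {}"
  shows "(\<Sum>v\<in>D. (-1) ^ p v * of_bool (\<forall>w\<in>D. (w < v \<longrightarrow> even (p w)) \<and> (v < w \<longrightarrow> odd (p w))))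
    = (of_bool (\<forall>w\<in>D. even (p w)) - of_bool (\<forall>w\<in>D. odd (p w)) :: 'r::comm_ring_1)"
  using assms
proof (induction D rule: finite_linorder_max_induct)
  case empty
  then show ?case by simp
next
  case (insert m D)
  let ?P = "\<lambda>D v. \<forall>w\<in>D. (w < v \<longrightarrow> even (p w)) \<and> (v < w \<longrightarrow> odd (p w))"
  have m: "?P (insert m D) m \<longleftrightarrow> (\<forall>w\<in>D. even (p w))" using insert.hyps by auto
  have v: "?P (insert m D) v \<longleftrightarrow> odd (p m) \<and> ?P D v" if "v \<in> D" for v
    using insert.hyps that by auto
  define S :: 'r where "S = (\<Sum>v\<in>D. (-1) ^ p v * of_bool (?P D v))"
  have "(\<Sum>v\<in>insert m D. (-1) ^ p v * of_bool (?P (insert m D) v))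
      = (-1) ^ p m * of_bool (?P (insert m D) m) + (\<Sum>v\<in>D. (-1) ^ p v * (of_bool (?P (insert m D) v) :: 'r))"
    using insert.hyps by (subst sum.insert) auto
  also have "(\<Sum>v\<in>D. (-1) ^ p v * (of_bool (?P (insert m D) v) :: 'r)) = of_bool (odd (p m)) * S"
    unfolding S_def sum_distrib_left by (rule sum.cong[OF refl]) (simp only: v of_bool_conj mult_ac)
  finally have step: "(\<Sum>v\<in>insert m D. (-1) ^ p v * of_bool (?P (insert m D) v))
      = (-1) ^ p m * of_bool (\<forall>w\<in>D. even (p w)) + of_bool (odd (p m)) * S"
    unfolding m .
  show ?case
  proof (cases "D = {}")
    case True
    then show ?thesis unfolding step by (simp add: S_def)
  next
    case False
    then have "\<not> ((\<forall>w\<in>D. even (p w)) \<and> (\<forall>w\<in>D. odd (p w)))" by auto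
    then show ?thesis
      using insert.IH[OF False] unfolding step S_def[symmetric] by auto
  qed
qed

text \<open>
  The coefficient of \<open>C\<close> runs over the vertices \<open>v\<close> for which \<open>insert v C\<close> satisfies the parity
  condition.  Adding \<open>v\<close> to \<open>C\<close> flips the parity of the vertices above \<open>v\<close> and of no others, so the sum is
  the one of \<open>alternating_sign_sum\<close>.  The result is independent of \<open>\<alpha>\<close>, as it must be for an
  element of \<open>\<mu>\<close>.
\<close>

lemma bd_gap_chain:
  assumes B: "B \<subseteq> {0..n}" and k: "Suc k < card B"
  shows "chain_bd (std_simplex n) (gap_chain \<alpha> B (Suc k))
    = (gap_chain Pos B k - gap_chain Neg B k :: nat list \<Rightarrow>\<^sub>0 'r::comm_ring_1)"
proof (rule chain_eqI)
  let ?G = "\<lambda>\<alpha> k. gap_chain \<alpha> B k :: nat list \<Rightarrow>\<^sub>0 'r"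
  show "chain_bd (std_simplex n) (?G \<alpha> (Suc k)) \<in> component (normalized_chains (std_simplex n)) k"
    by (intro chain_bd_component gap_chain_component B)
  have "Poly_Mapping.keys (?G Pos k - ?G Neg k) \<subseteq> Poly_Mapping.keys (?G Pos k) \<union> Poly_Mapping.keys (?G Neg k)"
    by (rule keys_diff)
  then show "?G Pos k - ?G Neg k \<in> component (normalized_chains (std_simplex n)) k"
    using gap_chain_component[OF B, of Pos k, where ?'r = 'r] gap_chain_component[OF B, of Neg k, where ?'r = 'r]
    by (auto simp: normalized_chains_def)
  fix C assume C: "C \<subseteq> {0..n}" "card C = Suc k"
  have fin: "finite B" "finite C" using B C finite_subset by blast+
  let ?D = "B - C"
  have D: "finite ?D" "?D \<noteq> {}" using fin k C card_mono[of C B] by auto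
  have "Poly_Mapping.lookup (chain_bd (std_simplex n) (?G \<alpha> (Suc k))) (simplex C)
      = (\<Sum>v\<in>{0..n} - C. (-1) ^ below C v * of_bool (insert v C \<in> gap_subsets \<alpha> B (Suc k)))"
    unfolding lookup_chain_bd[OF gap_chain_component[OF B] C]
    by (rule sum.cong[OF refl]) (use fin in \<open>simp only: lookup_gap_chain finite_insert\<close>)
  also have "\<dots> = (if C \<subseteq> B then (\<Sum>v\<in>?D. (-1) ^ below C v * of_bool (insert v C \<in> gap_subsets \<alpha> B (Suc k))) else 0)"
  proof (cases "C \<subseteq> B")
    case True
    have "(\<Sum>v\<in>?D. (-1) ^ below C v * (of_bool (insert v C \<in> gap_subsets \<alpha> B (Suc k)) :: 'r))
       = (\<Sum>v\<in>{0..n} - C. (-1) ^ below C v * of_bool (insert v C \<in> gap_subsets \<alpha> B (Suc k)))"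
      by (rule sum.mono_neutral_left) (use B in \<open>auto simp: gap_subsets_def\<close>)
    then show ?thesis using True by simp
  qed (auto simp: gap_subsets_def intro!: sum.neutral)
  also have "\<dots> = (if C \<subseteq> B then of_bool (\<forall>w\<in>?D. even (below C w)) - of_bool (\<forall>w\<in>?D. odd (below C w)) else 0)"
  proof -
    have ins: "insert v C \<in> gap_subsets \<alpha> B (Suc k) \<longleftrightarrow>
        (\<forall>w\<in>?D. (w < v \<longrightarrow> (even (below C w) \<longleftrightarrow> \<alpha> = Pos)) \<and> (v < w \<longrightarrow> (odd (below C w) \<longleftrightarrow> \<alpha> = Pos)))"
      if "C \<subseteq> B" "v \<in> ?D" for v
    proof -
      have "insert v C \<in> gap_subsets \<alpha> B (Suc k) \<longleftrightarrow>
         (\<forall>w\<in>?D - {v}. even (below C w + of_bool (v < w)) \<longleftrightarrow> \<alpha> = Pos)"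
        using that fin C by (auto simp: gap_subsets_def below_insert)
      also have "\<dots> \<longleftrightarrow> (\<forall>w\<in>?D. (w < v \<longrightarrow> (even (below C w) \<longleftrightarrow> \<alpha> = Pos)) \<and> (v < w \<longrightarrow> (odd (below C w) \<longleftrightarrow> \<alpha> = Pos)))"
        (is "?L \<longleftrightarrow> ?R")
      proof
        assume L: ?L
        show ?R
        proof
          fix w assume "w \<in> ?D"
          then show "(w < v \<longrightarrow> (even (below C w) \<longleftrightarrow> \<alpha> = Pos)) \<and> (v < w \<longrightarrow> (odd (below C w) \<longleftrightarrow> \<alpha> = Pos))"
            using bspec[OF L, of w] by (cases w v rule: linorder_cases) auto
        qed
      next
        assume R: ?R
        show ?L
        proof
          fix w assume "w \<in> ?D - {v}"
          then show "even (below C w + of_bool (v < w)) \<longleftrightarrow> \<alpha> = Pos"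
            using bspec[OF R, of w] by (cases w v rule: linorder_cases) auto
        qed
      qed
      finally show ?thesis .
    qed
    have "(\<Sum>v\<in>?D. (-1) ^ below C v * of_bool (insert v C \<in> gap_subsets \<alpha> B (Suc k)))
        = (of_bool (\<forall>w\<in>?D. even (below C w)) - of_bool (\<forall>w\<in>?D. odd (below C w)) :: 'r)" (is "?S = ?R")
      if CB: "C \<subseteq> B"
    proof -
      have S: "?S = (\<Sum>v\<in>?D. (-1) ^ below C v * of_bool (\<forall>w\<in>?D. (w < v \<longrightarrow> (even (below C w) \<longleftrightarrow> \<alpha> = Pos))
          \<and> (v < w \<longrightarrow> (odd (below C w) \<longleftrightarrow> \<alpha> = Pos))))"
        by (rule sum.cong[OF refl]) (simp only: ins[OF CB])
      show ?thesis
      proof (cases \<alpha>)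
        case Pos
        then show ?thesis
          using alternating_sign_sum[OF D, of "below C", where ?'r = 'r] unfolding S by simp
      next
        case Neg
        \<comment> \<open>The same sum with all parities shifted by one.\<close>
        have "?S = - (\<Sum>v\<in>?D. (-1) ^ Suc (below C v) * of_bool (\<forall>w\<in>?D. (w < v \<longrightarrow> even (Suc (below C w)))
            \<and> (v < w \<longrightarrow> odd (Suc (below C w)))))"
          unfolding S unfolding Neg sum_negf[symmetric] by (rule sum.cong) auto
        also have "\<dots> = ?R" 
          unfolding alternating_sign_sum[OF D] by simp
        finally show ?thesis .
      qed
    qed
    then show ?thesis by simp
  qed
  also have "\<dots> = Poly_Mapping.lookup (?G Pos k - ?G Neg k) (simplex C)"
    using fin C by (auto simp: lookup_minus lookup_gap_chain gap_subsets_def)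
  finally show "Poly_Mapping.lookup (chain_bd (std_simplex n) (?G \<alpha> (Suc k))) (simplex C)
    = Poly_Mapping.lookup (?G Pos k - ?G Neg k) (simplex C)" .
qed

lemma gap_chain_top:
  assumes "finite B" "card B = Suc k"
  shows "gap_chain \<alpha> B k = Poly_Mapping.single (simplex B) 1"
proof -
  have "gap_subsets \<alpha> B k = {B}"
    using assms by (auto simp: gap_subsets_def dest: card_subset_eq)
  then show ?thesis by (simp add: gap_chain_def)
qed

lemma gap_chain_above:
  assumes "finite B" "card B \<le> k"
  shows "gap_chain \<alpha> B k = 0"
proof -
  have "gap_subsets \<alpha> B k = {}"
    using assms by (auto simp: gap_subsets_def dest: card_mono)
  then show ?thesis by (simp add: gap_chain_def)
qed

lemma lookup_signed_part:
  "Poly_Mapping.lookup (signed_part \<alpha> c) x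
    = max (if \<alpha> = Pos then Poly_Mapping.lookup c x else - Poly_Mapping.lookup c x) 0"
  by (cases \<alpha>) (simp_all add: map.rep_eq when_def)

text \<open>
  The two gap chains in \<open>bd_gap_chain\<close> have no simplex in common below the top degree, so they are
  the positive and the negative part of the boundary, and Steiner's recursion stays among gap chains.
\<close>

lemma steiner_atom_gap_chain:
  assumes B: "B \<subseteq> {0..n}" "B \<noteq> {}"
  shows "steiner_atom (std_simplex n) (simplex B) k \<alpha> = gap_chain \<alpha> B k"
proof -
  let ?X = "std_simplex n"
  have fin: "finite B" using B finite_subset by blast
  then have cB: "0 < card B" using B by (simp add: card_gt_0_iff)
  have dim: "dim ?X (simplex B) = card B - 1" by (simp add: std_simplex_def)
  have step: "signed_part \<alpha> (chain_bd ?X (gap_chain \<alpha> B (Suc k))) = gap_chain \<alpha> B k"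
    if k: "Suc k < card B" for k
  proof (rule chain_eqI)
    let ?d = "gap_chain Pos B k - gap_chain Neg B k :: nat list \<Rightarrow>\<^sub>0 int"
    have sp: "Poly_Mapping.keys (signed_part \<alpha> c) \<subseteq> Poly_Mapping.keys c" for c :: "nat list \<Rightarrow>\<^sub>0 int"
      by (auto simp: in_keys_iff lookup_signed_part split: if_splits)
    show "signed_part \<alpha> (chain_bd ?X (gap_chain \<alpha> B (Suc k))) \<in> component (normalized_chains ?X) k"
      using chain_bd_component[OF gap_chain_component[OF B(1)], of \<alpha> k] sp
      by (fastforce simp: normalized_chains_def)
    show "gap_chain \<alpha> B k \<in> component (normalized_chains ?X) k"
      by (rule gap_chain_component[OF B(1)])
    fix C assume C: "C \<subseteq> {0..n}" "card C = Suc k"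
    have fC: "finite C" using C finite_subset by blast
    have "\<not> B \<subseteq> C" using k C fC card_mono[of C B] by auto
    then obtain v where "v \<in> B - C" by blast
    then have "\<not> (C \<in> gap_subsets Pos B k \<and> C \<in> gap_subsets Neg B k)"
      by (auto simp: gap_subsets_def)
    then show "Poly_Mapping.lookup (signed_part \<alpha> (chain_bd ?X (gap_chain \<alpha> B (Suc k)))) (simplex C)
        = Poly_Mapping.lookup (gap_chain \<alpha> B k) (simplex C)"
      using fin fC unfolding bd_gap_chain[OF B(1) k]
      by (cases \<alpha>) (auto simp: lookup_signed_part lookup_minus lookup_gap_chain simp del: signed_part.simps)
  qed
  have iter: "((\<lambda>c. signed_part \<alpha> (chain_bd ?X c)) ^^ r) (Poly_Mapping.single (simplex B) 1)
      = gap_chain \<alpha> B (card B - 1 - r)" if "r < card B" for r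
    using that
  proof (induction r)
    case 0
    then show ?case using fin by (simp add: gap_chain_top)
  next
    case (Suc r)
    then have "card B - 1 - r = Suc (card B - 1 - Suc r)" by simp
    then show ?case using Suc step[of "card B - 1 - Suc r"] by simp
  qed
  show ?thesis
  proof (cases "k < card B")
    case True
    then have "card B - 1 - (card B - 1 - k) = k" by simp
    then show ?thesis using True iter[of "card B - 1 - k"] unfolding steiner_atom_def dim by auto
  next
    case False
    then show ?thesis using fin cB unfolding steiner_atom_def dim by (simp add: gap_chain_above)
  qed
qed

text \<open>
  A single vertex of \<open>B\<close> has all others in the even gap below it only if it is the last one, and
  in the odd gap above it only if it is the first one.
\<close>

lemma gap_chain_unital:
  assumes B: "B \<subseteq> {0..n}" "B \<noteq> {}"
  shows "(\<Sum>v\<in>{0..n}. Poly_Mapping.lookup (gap_chain \<alpha> B 0) (simplex {v})) = (1::int)"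
proof -
  have fin: "finite B" using B finite_subset by blast
  let ?m = "case \<alpha> of Pos \<Rightarrow> Max B | Neg \<Rightarrow> Min B"
  have m: "?m \<in> B" using fin B by (cases \<alpha>) auto
  have "{v} \<in> gap_subsets \<alpha> B 0 \<longleftrightarrow> v = ?m" for v
  proof -
    have "below {v} w = of_bool (v < w)" for w
      by (auto simp: below_def Collect_conv_if)
    then have "{v} \<in> gap_subsets \<alpha> B 0 \<longleftrightarrow> v \<in> B \<and> (\<forall>w\<in>B - {v}. \<not> v < w \<longleftrightarrow> \<alpha> = Pos)"
      by (auto simp: gap_subsets_def)
    also have "\<dots> \<longleftrightarrow> ?m = v"
    proof (cases \<alpha>)
      case Pos
      then show ?thesis using Max_eq_iff[OF fin B(2), of v] by (auto simp: not_less)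
    next
      case Neg
      then show ?thesis using Min_eq_iff[OF fin B(2), of v] by (auto simp: le_less)
    qed
    finally show ?thesis by blast
  qed
  then have "(\<Sum>v\<in>{0..n}. Poly_Mapping.lookup (gap_chain \<alpha> B 0) (simplex {v})) = (\<Sum>v\<in>{0..n}. if v = ?m then 1 else (0::int))"
    using fin lookup_gap_chain[OF fin, of "{_}" \<alpha> 0, where ?'r = int] by (intro sum.cong) auto
  also have "\<dots> = 1" using m B by auto
  finally show ?thesis .
qed

section \<open>The atoms of the cup-\<open>i\<close> coalgebra\<close>

text \<open>
  Deleting from the largest index downwards leaves the smaller indices valid, so the iterated face
  keeps exactly the positions outside \<open>us\<close>.
\<close>

lemma foldr_face:
  assumes "sorted_wrt (<) us" "\<forall>u\<in>set us. u < length x"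
  shows "foldr (face (std_simplex n)) us x = nths x (- set us)"
  using assms
proof (induction us)
  case Nil
  then show ?case by (simp add: nths_all)
next
  case (Cons u us)
  define a where "a = take u x"
  define r where "r = drop (Suc u) x"
  have u: "u < length x" using Cons.prems by simp
  then have x: "x = a @ x ! u # r" and la: "length a = u"
    by (simp_all add: a_def r_def id_take_nth_drop)
  have above: "\<forall>v\<in>set us. u < v" using Cons.prems by auto
  have "\<forall>i<length a. i \<in> - set us" "\<forall>i<length a. i \<in> - set (u # us)"
    using above la by auto
  then have a: "nths a (- set us) = a" "nths a (- set (u # us)) = a"
    by (simp_all add: nths_all)
  define R where "R = nths r {j. Suc (j + u) \<in> - set us}"
  have 1: "nths x (- set us) = a @ x ! u # R"
    using above by (subst x) (auto simp: nths_append nths_Cons a la R_def)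
  have "{j. Suc (j + u) \<in> - set (u # us)} = {j. Suc (j + u) \<in> - set us}" by auto
  then have 2: "nths x (- set (u # us)) = a @ R"
    by (subst x) (simp add: nths_append nths_Cons a[simplified] la R_def)
  show ?case using Cons by (simp add: 1 2[simplified] la std_simplex_def)
qed

lemma faces_simplex:
  assumes B: "finite B" and U: "U \<subseteq> {..<card B}"
  shows "faces (std_simplex n) U (simplex B) = simplex (B - (!) (simplex B) ` U)"
proof -
  let ?e = "(!) (simplex B)"
  have fU: "finite U" using U finite_subset by blast
  have inj: "inj_on ?e {..<card B}" using B by (intro inj_on_nth) auto
  have eB: "?e ` {..<card B} = B"
    using B nth_image[of "card B" "simplex B"] by (simp add: lessThan_atLeast0)
  have "faces (std_simplex n) U (simplex B) = nths (simplex B) (- U)"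
    unfolding faces_def using foldr_face[of "simplex U" "simplex B" n] U B fU by auto
  moreover have "set (nths (simplex B) (- U)) = B - ?e ` U"
  proof -
    have "set (nths (simplex B) (- U)) = ?e ` ({..<card B} - U)"
      using B by (auto simp: set_nths)
    also have "\<dots> = ?e ` {..<card B} - ?e ` U" by (rule inj_on_image_set_diff[OF inj]) (use U in auto)
    finally show ?thesis unfolding eB .
  qed
  moreover have "simplex (set (nths (simplex B) (- U))) = nths (simplex B) (- U)"
    by (rule simplex_eqI) (auto intro: sorted_nths)
  ultimately show ?thesis by simp
qed

text \<open>
  Of the positions up to and including \<open>u\<close>, those in \<open>U\<close> are counted by \<open>position\<close> and the kept ones
  by \<open>below\<close>.  This turns the parities defining \<open>U\<^sup>\<plusminus>\<close> into parities of gaps.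
\<close>

lemma below_kept:
  assumes B: "finite B" and U: "U \<subseteq> {..<card B}" and u: "u \<in> U"
  shows "below (B - (!) (simplex B) ` U) (simplex B ! u) + position U u = Suc u"
proof -
  let ?e = "(!) (simplex B)"
  have fU: "finite U" using U finite_subset by blast
  have inj: "inj_on ?e {..<card B}" using B by (intro inj_on_nth) auto
  have eB: "?e ` {..<card B} = B"
    using B nth_image[of "card B" "simplex B"] by (simp add: lessThan_atLeast0)
  have mono: "?e i < ?e j \<longleftrightarrow> i < j" if "i < card B" "j < card B" for i j
    using that B strict_sorted_list_of_set[of B]
    by (metis length_sorted_list_of_set linorder_neqE_nat order.asym order_less_irrefl sorted_wrt_iff_nth_less)
  have uB: "u < card B" using u U by auto
  have "{w \<in> B - ?e ` U. w < ?e u} = ?e ` ({..<u} - U)"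
  proof -
    have "B - ?e ` U = ?e ` ({..<card B} - U)"
      using inj_on_image_set_diff[OF inj, of "{..<card B}" U] U unfolding eB by auto
    then have "{w \<in> B - ?e ` U. w < ?e u} = {w \<in> ?e ` ({..<card B} - U). w < ?e u}" by simp
    also have "\<dots> = ?e ` {i \<in> {..<card B} - U. ?e i < ?e u}" by auto
    also have "{i \<in> {..<card B} - U. ?e i < ?e u} = {..<u} - U"
      using mono uB by auto
    finally show ?thesis .
  qed
  moreover have "inj_on ?e ({..<u} - U)" by (rule inj_on_subset[OF inj]) (use uB in auto)
  ultimately have "below (B - ?e ` U) (?e u) = card ({..<u} - U)"
    by (simp add: below_def card_image)
  moreover have "position U u = card (insert u ({..<u} \<inter> U))"
    unfolding position_def by (rule arg_cong[where f = card]) (use u in auto)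
  moreover have "card ({..<u} \<inter> U) + card ({..<u} - U) = u"
    using card_Int_Diff[of "{..<u}" U] by simp
  ultimately show ?thesis using fU by simp
qed

lemma tensor_single:
  "tensor (Poly_Mapping.single a (1::bit)) (Poly_Mapping.single b 1) = Poly_Mapping.single (a, b) 1"
  by (simp add: tensor_def)

text \<open>
  A face of \<open>b\<close> equals \<open>b\<close> only if nothing is deleted, so \<open>\<pi>\<^sub>b\<close> retains the terms of the coproduct in which
  one of \<open>U\<^sup>+\<close>, \<open>U\<^sup>-\<close> is empty and the other is all of \<open>U\<close>.
\<close>

lemma steenrod_atom_gap_chain:
  assumes B: "B \<subseteq> {0..n}" "B \<noteq> {}"
  shows "atom (steenrod_coalgebra (std_simplex n)) (simplex B) k \<alpha> = gap_chain \<alpha> B k"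
proof -
  let ?X = "std_simplex n" and ?b = "simplex B" and ?e = "(!) (simplex B)"
  have fin: "finite B" using B finite_subset by blast
  then have cB: "0 < card B" using B by (simp add: card_gt_0_iff)
  have dim: "dim ?X ?b = card B - 1" by (simp add: std_simplex_def)
  have inj: "inj_on ?e {..<card B}" using fin by (intro inj_on_nth) auto
  have eB: "?e ` {..<card B} = B"
    using fin nth_image[of "card B" "simplex B"] by (simp add: lessThan_atLeast0)
  define I where "I = {U. U \<subseteq> {..<card B} \<and> card U + k = card B - 1}"
  have I: "{U. U \<subseteq> {0..dim ?X ?b} \<and> card U + k = dim ?X ?b} = I"
  proof -
    have "{0..card B - 1} = {..<card B}" using cB by auto
    then show ?thesis by (simp only: I_def dim)
  qed
  have finI: "finite I" unfolding I_def by (rule finite_subset[of _ "Pow {..<card B}"]) auto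
  define F where "F U = B - ?e ` U" for U
  have faces: "faces ?X V ?b = simplex (F V)" if "V \<subseteq> U" "U \<in> I" for U V
    unfolding F_def using that fin by (intro faces_simplex) (auto simp: I_def)
  have card_F: "card (F V) + card V = card B" if "V \<subseteq> {..<card B}" for V
  proof -
    have "?e ` V \<subseteq> B" using that eB by blast
    moreover have "card (?e ` V) = card V" using that inj by (metis card_image inj_on_subset)
    moreover have "card V \<le> card B" using card_mono[OF _ that] by simp
    ultimately show ?thesis unfolding F_def using fin by (simp add: card_Diff_subset finite_subset)
  qed
  have F_B: "simplex (F V) = ?b \<longleftrightarrow> V = {}" if "V \<subseteq> U" "U \<in> I" for U V
  proof -
    have "V \<subseteq> {..<card B}" using that by (auto simp: I_def)
    moreover have "finite V" using calculation finite_subset by blast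
    moreover have "finite (F V)" using fin by (simp add: F_def)
    ultimately show ?thesis using card_F[of V] fin simplex_inj[of "F V" B] by (auto simp: F_def)
  qed
  have cls: "chain_class ?X (faces ?X V ?b) = Poly_Mapping.single (simplex (F V)) (1::bit)"
    if "V \<subseteq> U" "U \<in> I" for U V
  proof -
    have U: "U \<subseteq> {..<card B}" "V \<subseteq> {..<card B}" "card U < card B" "finite U"
      using that cB finite_subset[of U "{..<card B}"] by (auto simp: I_def)
    have "card V \<le> card U" using that U by (intro card_mono) auto
    then have "0 < card (F V)" using card_F[OF U(2)] U(3) by simp
    then have "F V \<noteq> {}" by auto
    moreover have "F V \<subseteq> {0..n}" "finite (F V)" using B fin by (auto simp: F_def)
    ultimately have "simplex (F V) \<in> nondegenerate ?X"
      by (auto simp: nondegenerate_std_simplex)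
    then show ?thesis using faces[OF that] by (simp add: chain_class_def)
  qed
  have sub: "U_neg U \<subseteq> U" "U_pos U \<subseteq> U" for U by (auto simp: U_neg_def U_pos_def)
  have cop: "cop (steenrod_coalgebra ?X) k (Poly_Mapping.single ?b 1)
      = (\<Sum>U\<in>I. Poly_Mapping.single (simplex (F (U_neg U)), simplex (F (U_pos U))) 1)"
    unfolding steenrod_coalgebra_def cup_coproduct_def
    using I by (simp add: lin_ext_single) (intro sum.cong[OF refl], simp add: cls[OF sub(1)] cls[OF sub(2)] tensor_single)
  have neg1: "(-1::bit) ^ j = 1" for j by simp
  have scale1: "scale 1 c = c" for c :: "nat list \<Rightarrow>\<^sub>0 bit"
    by (rule poly_mapping_eqI) (simp add: lookup_scale)
  have proj: "proj_pos ?b (\<Sum>U\<in>I. Poly_Mapping.single (x U, y U) (1::bit))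
      = (\<Sum>U\<in>I. if y U = ?b then Poly_Mapping.single (x U) 1 else 0)" for x y
    unfolding proj_pos_def lin_ext_sum lin_ext_single by simp
  have tw: "twist (steenrod_coalgebra ?X) (\<Sum>U\<in>I. Poly_Mapping.single (x U, y U) (1::bit))
      = (\<Sum>U\<in>I. Poly_Mapping.single (y U, x U) 1)" for x y
    unfolding twist_def lin_ext_sum lin_ext_single neg1 by simp
  have pos: "U_pos U = {} \<longleftrightarrow> F U \<in> gap_subsets Pos B k"
    and neg: "U_neg U = {} \<longleftrightarrow> F U \<in> gap_subsets Neg B k" if U: "U \<in> I" for U
  proof -
    have U': "U \<subseteq> {..<card B}" using U by (simp add: I_def)
    have "card (F U) = Suc k" using card_F[OF U'] U cB by (auto simp: I_def)
    moreover have "B - F U = ?e ` U" using U' eB unfolding F_def by blast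
    ultimately have gap: "F U \<in> gap_subsets \<alpha> B k \<longleftrightarrow> (\<forall>u\<in>U. even (below (F U) (?e u)) \<longleftrightarrow> \<alpha> = Pos)" for \<alpha>
      by (auto simp: gap_subsets_def F_def)
    have par: "even (below (F U) (?e u)) \<longleftrightarrow> u mod 2 \<noteq> position U u mod 2" if "u \<in> U" for u
      using below_kept[OF fin U' that] unfolding F_def[symmetric] by presburger
    show "U_pos U = {} \<longleftrightarrow> F U \<in> gap_subsets Pos B k"
      unfolding gap U_pos_def using par by auto
    show "U_neg U = {} \<longleftrightarrow> F U \<in> gap_subsets Neg B k"
      unfolding gap U_neg_def using par by auto
  qed
  have other: "U_pos U = {} \<Longrightarrow> U_neg U = U" "U_neg U = {} \<Longrightarrow> U_pos U = U" for U
    by (auto simp: U_neg_def U_pos_def)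
  have "atom (steenrod_coalgebra ?X) ?b k \<alpha>
      = (\<Sum>U\<in>I. if F U \<in> gap_subsets \<alpha> B k then Poly_Mapping.single (simplex (F U)) 1 else 0)"
  proof (cases \<alpha>)
    case Pos
    then show ?thesis
      by (simp only: atom.simps cop proj)
        (intro sum.cong[OF refl], use F_B[OF sub(2)] pos other in auto)
  next
    case Neg
    then show ?thesis
      by (simp only: atom.simps proj_neg_def cop tw proj neg1 scale1)
        (intro sum.cong[OF refl], use F_B[OF sub(1)] neg other in auto)
  qed
  also have "\<dots> = (\<Sum>U\<in>{U \<in> I. F U \<in> gap_subsets \<alpha> B k}. Poly_Mapping.single (simplex (F U)) 1)"
    using finI by (rule sum.inter_filter[symmetric])
  also have "\<dots> = gap_chain \<alpha> B k"
    unfolding gap_chain_def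
  proof (rule sum.reindex_bij_witness[where i = "\<lambda>C. {i. i < card B \<and> ?e i \<notin> C}" and j = F])
    fix U assume U: "U \<in> {U \<in> I. F U \<in> gap_subsets \<alpha> B k}"
    then have "U \<subseteq> {..<card B}" by (auto simp: I_def)
    then show "{i. i < card B \<and> ?e i \<notin> F U} = U"
      using eB inj by (auto simp: F_def inj_on_def)
    show "F U \<in> gap_subsets \<alpha> B k" using U by simp
  next
    fix C assume C: "C \<in> gap_subsets \<alpha> B k"
    let ?U = "{i. i < card B \<and> ?e i \<notin> C}"
    have "C \<subseteq> B" "card C = Suc k" using C by (auto simp: gap_subsets_def)
    moreover have FU: "F ?U = C" using \<open>C \<subseteq> B\<close> eB by (auto simp: F_def)
    moreover have "?U \<subseteq> {..<card B}" by auto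
    ultimately have "?U \<in> I" using card_F[of ?U] by (simp add: I_def)
    then show "?U \<in> {U \<in> I. F U \<in> gap_subsets \<alpha> B k}" "F ?U = C" using FU C by auto
  qed simp
  finally show ?thesis .
qed

section \<open>Isomorphisms between generated \<open>\<omega>\<close>-categories\<close>

lemma omega_isoI:
  assumes F: "omega_functor X Y F" and bij: "\<And>n. bij_betw (F n) (cells X n) (cells Y n)"
  shows "omega_iso X Y F"
proof -
  interpret omega_functor X Y F by (rule F)
  define G where "G n = inv_into (cells X n) (F n)" for n
  have GF: "G n (F n x) = x" if "x \<in> cells X n" for n x
    using bij[of n] that unfolding G_def bij_betw_def by simp
  have FG: "F n (G n y) = y" and G: "G n y \<in> cells X n" if "y \<in> cells Y n" for n y
    using bij[of n] that unfolding G_def bij_betw_def by (auto simp: f_inv_into_f inv_into_into)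
  have "omega_functor Y X G"
  proof (intro omega_functor.intro omega_functor_axioms.intro)
    show "omega_category Y" "omega_category X" by unfold_locales
    fix n y assume y: "y \<in> cells Y n"
    then show "G n y \<in> cells X n" by (rule G)
    show "G (Suc n) (idt Y (Suc n) y) = idt X (Suc n) (G n y)"
      using map_idt[OF G[OF y]] FG[OF y] GF X.idt_cell[OF G[OF y]] by metis
  next
    fix m n y assume m: "m < n" and y: "y \<in> cells Y n"
    show "G m (src Y n m y) = src X n m (G n y)"
      using map_src[OF m G[OF y]] FG[OF y] GF X.src_cell[OF m G[OF y]] by metis
    show "G m (tgt Y n m y) = tgt X n m (G n y)"
      using map_tgt[OF m G[OF y]] FG[OF y] GF X.tgt_cell[OF m G[OF y]] by metis
  next
    fix n m y x assume c: "composable Y n m y x"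
    then have yx: "m < n" "x \<in> cells Y n" "y \<in> cells Y n" "src Y n m y = tgt Y n m x"
      by (auto simp: composable_def)
    have "F m (src X n m (G n y)) = F m (tgt X n m (G n x))"
      using map_src[OF yx(1) G[OF yx(3)]] map_tgt[OF yx(1) G[OF yx(2)]] FG yx by simp
    then have "src X n m (G n y) = tgt X n m (G n x)"
      using GF X.src_cell[OF yx(1) G[OF yx(3)]] X.tgt_cell[OF yx(1) G[OF yx(2)]] by metis
    then have cX: "composable X n m (G n y) (G n x)" using yx G by (auto simp: composable_def)
    show "G n (comp Y n m y x) = comp X n m (G n y) (G n x)"
      using map_comp[OF cX] FG yx GF X.comp_cell[OF cX] by metis
  qed
  then show ?thesis unfolding omega_iso_def using F GF FG by blast
qed

lemma sub_omega_generated_simps [simp]: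
  "cells (sub_omega_generated X S) n = {x. generated_cell X S n x}"
  "src (sub_omega_generated X S) = src X"
  "tgt (sub_omega_generated X S) = tgt X"
  "idt (sub_omega_generated X S) = idt X"
  "comp (sub_omega_generated X S) = comp X"
  by (auto simp: sub_omega_generated_def)

lemma generated_cell_in_cells:
  assumes "omega_category X" "\<And>n. S n \<subseteq> cells X n" "generated_cell X S n x"
  shows "x \<in> cells X n"
proof -
  interpret omega_category X by fact
  show ?thesis using assms(3)
    by (induction rule: generated_cell.induct)
      (use assms(2) in \<open>auto simp: src_cell tgt_cell idt_cell composable_def intro!: comp_cell\<close>)
qed

text \<open>
  In general the image of a generated sub-\<open>\<omega>\<close>-category need not be closed under composition, as
  cells with composable images need not be composable.
\<close>

lemma omega_iso_generated:
  assumes F: "omega_functor X Y F" and S: "\<And>n. S n \<subseteq> cells X n"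
    and inj: "\<And>n. inj_on (F n) {x. generated_cell X S n x}"
  shows "omega_iso (sub_omega_generated X S) (sub_omega_generated Y (\<lambda>n. F n ` S n)) F"
proof -
  interpret omega_functor X Y F by (rule F)
  let ?T = "\<lambda>n. F n ` S n"
  have T: "?T n \<subseteq> cells Y n" for n using S map_cell by blast
  have cell: "generated_cell X S n x \<Longrightarrow> x \<in> cells X n" for n x
    by (rule generated_cell_in_cells[OF X.omega_category_axioms S])
  have img: "generated_cell Y ?T n (F n x)" if "generated_cell X S n x" for n x
    using that
  proof (induction rule: generated_cell.induct)
    case (gen x n)
    then show ?case by (intro generated_cell.gen) auto
  next
    case (gen_src n x m)
    then show ?case by (simp add: map_src cell generated_cell.gen_src)
  next
    case (gen_tgt n x m)
    then show ?case by (simp add: map_tgt cell generated_cell.gen_tgt)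
  next
    case (gen_idt n x)
    then show ?case by (simp add: map_idt cell generated_cell.gen_idt)
  next
    case (gen_comp n x y m)
    then have c: "composable X n m y x" by (simp add: composable_def cell)
    have "src Y n m (F n y) = tgt Y n m (F n x)"
      using map_src[of m n y] map_tgt[of m n x] gen_comp cell by simp
    then show ?case using gen_comp by (simp add: map_comp[OF c] generated_cell.gen_comp)
  qed
  have surj: "\<exists>x. generated_cell X S n x \<and> F n x = y" if "generated_cell Y ?T n y" for n y
    using that
  proof (induction rule: generated_cell.induct)
    case (gen y n)
    then show ?case by (auto intro: generated_cell.gen)
  next
    case (gen_src n y m)
    then show ?case using map_src cell generated_cell.gen_src by metis
  next
    case (gen_tgt n y m)
    then show ?case using map_tgt cell generated_cell.gen_tgt by metis
  next
    case (gen_idt n y)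
    then show ?case using map_idt cell generated_cell.gen_idt by metis
  next
    case (gen_comp n y y' m)
    then obtain x x' where x: "generated_cell X S n x" "F n x = y"
      and x': "generated_cell X S n x'" "F n x' = y'" by blast
    \<comment> \<open>Two cells of \<open>X\<close> with composable images are composable because \<open>F\<close> is injective on generated cells.\<close>
    have "F m (src X n m x') = F m (tgt X n m x)"
      using gen_comp.hyps x x' map_src[OF gen_comp.hyps(3) cell[OF x'(1)]]
        map_tgt[OF gen_comp.hyps(3) cell[OF x(1)]] by simp
    moreover have "generated_cell X S m (src X n m x')" "generated_cell X S m (tgt X n m x)"
      using x x' gen_comp.hyps(3) by (simp_all add: generated_cell.gen_src generated_cell.gen_tgt)
    ultimately have st: "src X n m x' = tgt X n m x" using inj[of m] by (simp add: inj_on_def)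
    then have "composable X n m x' x" using x x' gen_comp.hyps(3) by (simp add: composable_def cell)
    then have "F n (comp X n m x' x) = comp Y n m y' y" using x x' map_comp by simp
    moreover have "generated_cell X S n (comp X n m x' x)"
      using x x' st gen_comp.hyps(3) by (simp add: generated_cell.gen_comp)
    ultimately show ?case by blast
  qed
  show ?thesis
  proof (rule omega_isoI)
    show "omega_functor (sub_omega_generated X S) (sub_omega_generated Y ?T) F"
    proof (intro omega_functor.intro omega_functor_axioms.intro)
      show "omega_category (sub_omega_generated X S)" "omega_category (sub_omega_generated Y ?T)"
        by (rule omega_category_generated[OF X.omega_category_axioms S],
            rule omega_category_generated[OF Y.omega_category_axioms T])
      fix n m y x assume "composable (sub_omega_generated X S) n m y x"
      then have "composable X n m y x" by (auto simp: composable_def cell)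
      then show "F n (comp (sub_omega_generated X S) n m y x)
          = comp (sub_omega_generated Y ?T) n m (F n y) (F n x)"
        by (simp add: map_comp)
    qed (auto simp: img map_src map_tgt map_idt cell)
    show "bij_betw (F n) (cells (sub_omega_generated X S) n) (cells (sub_omega_generated Y ?T) n)" for n
      using inj[of n] img surj unfolding bij_betw_def by (fastforce simp: image_iff)
  qed
qed


section \<open>Reduction modulo 2\<close>

lemma mu_simps [simp]:
  "src (mu C) n m = mu_end Neg m" "tgt (mu C) n m = mu_end Pos m" "idt (mu C) n c = c"
  by (simp_all add: mu_def)

lemma omega_functor_mu_map:
  assumes "omega_category (mu C)" "omega_category (mu D)"
    and comp: "\<And>k x. x \<in> component C k \<Longrightarrow> f x \<in> component D k"
    and add: "\<And>x y. f (x + y) = f x + f y"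
    and bd: "\<And>x. bd D (f x) = f (bd C x)"
  shows "omega_functor (mu C) (mu D) (\<lambda>_. mu_map f)"
proof (intro omega_functor.intro omega_functor_axioms.intro assms)
  have zero: "f 0 = 0" using add[of 0 0] by simp
  have diff: "f (x - y) = f x - f y" for x y using add[of "x - y" y] by (simp add: algebra_simps)
  have mu_end: "mu_map f (mu_end \<alpha> m c) = mu_end \<alpha> m (mu_map f c)" for \<alpha> m c
    by (auto simp: mu_map_def mu_end_def zero fun_eq_iff)
  fix n m
  show "mu_map f x \<in> cells (mu D) n" if "x \<in> cells (mu C) n" for x
    using that comp unfolding mu_def mu_carrier_def
    by (auto simp: mu_map_def bd diff zero intro!: exI[of _ n])
  show "mu_map f (src (mu C) n m x) = src (mu D) n m (mu_map f x)"
    "mu_map f (tgt (mu C) n m x) = tgt (mu D) n m (mu_map f x)"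
    "mu_map f (idt (mu C) (Suc n) x) = idt (mu D) (Suc n) (mu_map f x)" for x
    by (simp_all add: mu_end)
  show "mu_map f (omega_data.comp (mu C) n m y x) = omega_data.comp (mu D) n m (mu_map f y) (mu_map f x)" for y x
    using mu_end[of Pos m x]
    by (auto simp: mu_def mu_map_def add diff fun_eq_iff)
qed

lemma omega_category_mu_normalized_chains:
  "omega_category (mu (normalized_chains X :: ('x \<Rightarrow>\<^sub>0 'r::comm_ring_1) dg_module))"
proof (rule mu_omega_category)
  fix n and x y :: "'x \<Rightarrow>\<^sub>0 'r"
  assume xy: "x \<in> component (normalized_chains X) n" "y \<in> component (normalized_chains X) n"
  show "x + y \<in> component (normalized_chains X) n"
    using xy keys_add[of x y] by (auto simp: normalized_chains_def)
  show "x - y \<in> component (normalized_chains X) n"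
    using xy keys_diff[of x y] by (auto simp: normalized_chains_def)
qed (simp_all add: normalized_chains_def chain_bd_def lin_ext_zero lin_ext_add lin_ext_diff)

lemma mu_steenrod_coalgebra: "mu (steenrod_coalgebra X) = mu (normalized_chains X)"
  by (simp add: mu_def mu_carrier_def steenrod_coalgebra_def normalized_chains_def)

lemma lookup_reduce_mod_2:
  "Poly_Mapping.lookup (reduce_mod_2 c) x = of_int (Poly_Mapping.lookup c x)"
  by (simp add: reduce_mod_2_def map.rep_eq when_def)

lemma keys_reduce_mod_2: "Poly_Mapping.keys (reduce_mod_2 c) \<subseteq> Poly_Mapping.keys c"
  by (auto simp: in_keys_iff lookup_reduce_mod_2)

lemma chain_bd_reduce_mod_2: "chain_bd X (reduce_mod_2 c) = reduce_mod_2 (chain_bd X c)"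
proof (rule poly_mapping_eqI)
  fix y
  have cls: "(Poly_Mapping.lookup (chain_class X x) y :: bit) = of_int (Poly_Mapping.lookup (chain_class X x) y)" for x
    by (auto simp: chain_class_def lookup_single when_def)
  show "Poly_Mapping.lookup (chain_bd X (reduce_mod_2 c)) y
      = Poly_Mapping.lookup (reduce_mod_2 (chain_bd X c)) y"
    unfolding chain_bd_def lookup_reduce_mod_2
    apply (subst lookup_lin_ext[OF finite_keys keys_reduce_mod_2])
    apply (subst lookup_lin_ext[OF finite_keys order_refl])
    unfolding of_int_sum of_int_mult lookup_reduce_mod_2
    apply (rule sum.cong[OF refl])
    apply (rule arg_cong[where f = "(*) _"])
    by (simp add: lookup_sum lookup_scale cls)
qed

definition gap_cell :: "nat set \<Rightarrow> (nat list \<Rightarrow>\<^sub>0 'r::comm_ring_1) mu_seq" where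
  "gap_cell B k \<alpha> = gap_chain \<alpha> B k"

lemma reduce_gap_cell:
  assumes "B \<subseteq> {0..n}"
  shows "mu_map reduce_mod_2 (gap_cell B) = gap_cell B"
proof (intro ext)
  fix k \<alpha>
  have "reduce_mod_2 (gap_chain \<alpha> B k) = gap_chain \<alpha> B k"
  proof (rule chain_eqI)
    show "reduce_mod_2 (gap_chain \<alpha> B k) \<in> component (normalized_chains (std_simplex n)) k"
      using gap_chain_component[OF assms, of \<alpha> k] keys_reduce_mod_2
      by (fastforce simp: normalized_chains_def)
    fix C assume "C \<subseteq> {0..n}"
    then have "finite B" "finite C" using assms finite_subset by blast+
    then show "Poly_Mapping.lookup (reduce_mod_2 (gap_chain \<alpha> B k)) (simplex C)
        = Poly_Mapping.lookup (gap_chain \<alpha> B k) (simplex C)"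
      by (simp add: lookup_reduce_mod_2 lookup_gap_chain)
  qed (rule gap_chain_component[OF assms])
  then show "mu_map reduce_mod_2 (gap_cell B) k \<alpha> = gap_cell B k \<alpha>"
    by (simp add: mu_map_def gap_cell_def)
qed

lemma gap_cell_in_mu:
  assumes B: "B \<subseteq> {0..n}" "card B = Suc m"
  shows "gap_cell B \<in> cells (mu (normalized_chains (std_simplex n) :: (nat list \<Rightarrow>\<^sub>0 'r::comm_ring_1) dg_module)) m"
proof -
  let ?G = "\<lambda>\<alpha> k. gap_chain \<alpha> B k :: nat list \<Rightarrow>\<^sub>0 'r"
  have fin: "finite B" using B finite_subset by blast
  have zero: "?G \<alpha> k = 0" if "m < k" for \<alpha> k using that B fin by (simp add: gap_chain_above)
  have "chain_bd (std_simplex n) (?G \<alpha> (Suc k)) = ?G Pos k - ?G Neg k" for k \<alpha>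
  proof (cases k m rule: linorder_cases)
    case less
    then show ?thesis using B by (intro bd_gap_chain) auto
  next
    case equal
    then show ?thesis using B fin zero[of "Suc k" \<alpha>]
      by (simp add: gap_chain_top chain_bd_def lin_ext_zero)
  next
    case greater
    then show ?thesis using zero[of "Suc k"] zero[of k] by (simp add: chain_bd_def lin_ext_zero)
  qed
  then show ?thesis
    using zero gap_chain_component[OF B(1), where ?'r = 'r]
    by (auto simp: mu_def mu_carrier_def gap_cell_def normalized_chains_def intro!: exI[of _ m])
qed

lemma atoms_eq_gap_cells:
  "steiner_atom (std_simplex n) ` {b \<in> nondegenerate (std_simplex n). dim (std_simplex n) b = m}
    = gap_cell ` {B. B \<subseteq> {0..n} \<and> card B = Suc m}"
  "atom (steenrod_coalgebra (std_simplex n)) ` {b \<in> nondegenerate (std_simplex n). dim (std_simplex n) b = m}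
    = gap_cell ` {B. B \<subseteq> {0..n} \<and> card B = Suc m}"
proof -
  have "steiner_atom (std_simplex n) (simplex B) = gap_cell B"
    "atom (steenrod_coalgebra (std_simplex n)) (simplex B) = gap_cell B"
    if "B \<in> {B. B \<subseteq> {0..n} \<and> card B = Suc m}" for B
  proof -
    have "B \<subseteq> {0..n}" "B \<noteq> {}" using that by auto
    then show "steiner_atom (std_simplex n) (simplex B) = gap_cell B"
      "atom (steenrod_coalgebra (std_simplex n)) (simplex B) = gap_cell B"
      by (simp_all add: fun_eq_iff gap_cell_def steiner_atom_gap_chain steenrod_atom_gap_chain)
  qed
  then show "steiner_atom (std_simplex n) ` {b \<in> nondegenerate (std_simplex n). dim (std_simplex n) b = m}
      = gap_cell ` {B. B \<subseteq> {0..n} \<and> card B = Suc m}"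
    "atom (steenrod_coalgebra (std_simplex n)) ` {b \<in> nondegenerate (std_simplex n). dim (std_simplex n) b = m}
      = gap_cell ` {B. B \<subseteq> {0..n} \<and> card B = Suc m}"
    unfolding nondeg_simplex image_image by (intro image_cong; simp)+
qed

lemma mu_comp_eq:
  assumes "mu_end Neg m y = mu_end Pos m x"
  shows "comp (mu C) n m y x j \<alpha>
    = (if j < m then y j \<alpha> else if j = m then (if \<alpha> = Pos then y m Pos else x m Neg) else y j \<alpha> + x j \<alpha>)"
proof -
  have "y j \<alpha> = x j \<alpha>" if "j < m" for j \<alpha>
    using fun_cong[OF fun_cong[OF assms, of j], of \<alpha>] that by (simp add: mu_end_def)
  moreover have "y m Neg = x m Pos"
    using fun_cong[OF fun_cong[OF assms, of m], of Pos] by (simp add: mu_end_def)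
  ultimately show ?thesis by (cases \<alpha>) (auto simp: mu_def mu_end_def)
qed

definition positive_unital :: "nat \<Rightarrow> (nat list \<Rightarrow>\<^sub>0 int) mu_seq \<Rightarrow> bool" where
  "positive_unital n c \<longleftrightarrow> (\<forall>k \<alpha> x. 0 \<le> Poly_Mapping.lookup (c k \<alpha>) x)
     \<and> (\<forall>\<alpha>. (\<Sum>v\<in>{0..n}. Poly_Mapping.lookup (c 0 \<alpha>) (simplex {v})) = 1)"

text \<open>
  Positivity survives composition because the subtracted term cancels: \<open>mu_comp_eq\<close> expresses each
  component of a composite as a component of a factor or as a sum of two.
\<close>

lemma oriental_cell_positive_unital:
  assumes "generated_cell (mu C) (\<lambda>m. gap_cell ` {B. B \<subseteq> {0..n} \<and> card B = Suc m}) m c"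
  shows "positive_unital n c"
  using assms
proof (induction rule: generated_cell.induct)
  case (gen c m)
  then obtain B where B: "c = gap_cell B" "B \<subseteq> {0..n}" "card B = Suc m" by auto
  then have "B \<noteq> {}" "finite B" using finite_subset by auto
  moreover have "0 \<le> Poly_Mapping.lookup (gap_chain \<alpha> B k :: _ \<Rightarrow>\<^sub>0 int) x" for \<alpha> k x
    unfolding gap_chain_def lookup_sum by (intro sum_nonneg) (simp add: lookup_single when_def)
  ultimately show ?case
    using B gap_chain_unital[OF B(2)] by (simp add: positive_unital_def gap_cell_def)
next
  case (gen_src m c k)
  then show ?case by (auto simp: positive_unital_def mu_end_def)
next
  case (gen_tgt m c k)
  then show ?case by (auto simp: positive_unital_def mu_end_def)
next
  case (gen_idt m c)
  then show ?case by simp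
next
  case (gen_comp m c d k)
  then have e: "mu_end Neg k d = mu_end Pos k c" by simp
  show ?case using gen_comp.IH unfolding positive_unital_def mu_comp_eq[OF e]
    by (auto simp: lookup_add)
qed

lemma positive_unital_coefficient_le_1:
  assumes c: "c \<in> mu_carrier (normalized_chains (std_simplex n))" "positive_unital n c"
    and C: "C \<subseteq> {0..n}" "card C = Suc k"
  shows "Poly_Mapping.lookup (c k \<alpha>) (simplex C) \<le> 1"
proof (rule cell_coefficient_le_1[where x = "\<lambda>k \<alpha> C. Poly_Mapping.lookup (c k \<alpha>) (simplex C)", OF _ _ _ C])
  fix k \<alpha> C assume C: "C \<subseteq> {0..n}" "card C = Suc k"
  have "Poly_Mapping.lookup (c k Pos) (simplex C) - Poly_Mapping.lookup (c k Neg) (simplex C)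
      = Poly_Mapping.lookup (chain_bd (std_simplex n) (c (Suc k) \<alpha>)) (simplex C)"
    using mu_carrierD(2)[OF c(1), of k \<alpha>] by (simp add: normalized_chains_def lookup_minus)
  also have "\<dots> = (\<Sum>v\<in>{0..n} - C. (-1) ^ below C v * Poly_Mapping.lookup (c (Suc k) \<alpha>) (simplex (insert v C)))"
    by (rule lookup_chain_bd[OF mu_carrierD(1)[OF c(1)] C])
  finally show "Poly_Mapping.lookup (c k Pos) (simplex C) - Poly_Mapping.lookup (c k Neg) (simplex C)
      = (\<Sum>v\<in>{0..n} - C. (-1) ^ below C v * Poly_Mapping.lookup (c (Suc k) \<alpha>) (simplex (insert v C)))" .
qed (use c(2) in \<open>simp_all only: positive_unital_def\<close>)

lemma reduce_mod_2_inj_on_positive_unital: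
  "inj_on (mu_map reduce_mod_2) {c \<in> mu_carrier (normalized_chains (std_simplex n)). positive_unital n c}"
proof (rule inj_onI)
  let ?N = "normalized_chains (std_simplex n) :: (nat list \<Rightarrow>\<^sub>0 int) dg_module"
  fix c d assume c: "c \<in> {c \<in> mu_carrier ?N. positive_unital n c}"
    and d: "d \<in> {c \<in> mu_carrier ?N. positive_unital n c}"
    and eq: "mu_map reduce_mod_2 c = mu_map reduce_mod_2 d"
  show "c = d"
  proof (intro ext)
    fix k \<alpha>
    show "c k \<alpha> = d k \<alpha>"
    proof (rule chain_eqI)
      show "c k \<alpha> \<in> component ?N k" "d k \<alpha> \<in> component ?N k"
        using c d by (auto simp: mu_carrierD(1))
      fix C assume C: "C \<subseteq> {0..n}" "card C = Suc k"
      have le: "Poly_Mapping.lookup (e k \<alpha>) (simplex C) \<in> {0, 1}"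
        if "e \<in> {c \<in> mu_carrier ?N. positive_unital n c}" for e
      proof -
        have "Poly_Mapping.lookup (e k \<alpha>) (simplex C) \<le> 1"
          using that C by (intro positive_unital_coefficient_le_1) auto
        moreover have "0 \<le> Poly_Mapping.lookup (e k \<alpha>) (simplex C)"
          using that by (simp add: positive_unital_def)
        ultimately show ?thesis by (auto simp: order_antisym_conv)
      qed
      have "reduce_mod_2 (c k \<alpha>) = reduce_mod_2 (d k \<alpha>)"
        using fun_cong[OF fun_cong[OF eq, of k], of \<alpha>] by (simp add: mu_map_def)
      then have "(of_int (Poly_Mapping.lookup (c k \<alpha>) (simplex C)) :: bit)
          = of_int (Poly_Mapping.lookup (d k \<alpha>) (simplex C))"
        by (metis lookup_reduce_mod_2)
      then show "Poly_Mapping.lookup (c k \<alpha>) (simplex C) = Poly_Mapping.lookup (d k \<alpha>) (simplex C)"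
        using le[OF c] le[OF d] by auto
    qed
  qed
qed

theorem theorem17:
  fixes n :: nat
  shows "omega_iso (oriental n) (xi (steenrod_coalgebra (std_simplex n)))
           (\<lambda>_. mu_map reduce_mod_2)"
proof -
  let ?S = "\<lambda>m. gap_cell ` {B. B \<subseteq> {0..n} \<and> card B = Suc m}"
  let ?N = "normalized_chains (std_simplex n) :: (nat list \<Rightarrow>\<^sub>0 int) dg_module"
  let ?N2 = "normalized_chains (std_simplex n) :: (nat list \<Rightarrow>\<^sub>0 bit) dg_module"
  have ori: "oriental n = sub_omega_generated (mu ?N) ?S"
    unfolding oriental_def atoms_eq_gap_cells ..
  have "xi (steenrod_coalgebra (std_simplex n)) = sub_omega_generated (mu ?N2) ?S"
    unfolding xi_def mu_steenrod_coalgebra atoms_eq_gap_cells(2)[symmetric]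
    by (simp add: steenrod_coalgebra_def)
  also have "?S = (\<lambda>m. mu_map reduce_mod_2 ` ?S m)"
    unfolding image_image by (intro ext image_cong refl) (simp add: reduce_gap_cell[of _ n])
  finally have xi: "xi (steenrod_coalgebra (std_simplex n))
      = sub_omega_generated (mu ?N2) (\<lambda>m. mu_map reduce_mod_2 ` ?S m)" .
  have S: "?S m \<subseteq> cells (mu ?N) m" for m
    using gap_cell_in_mu by auto
  have F: "omega_functor (mu ?N) (mu ?N2) (\<lambda>_. mu_map reduce_mod_2)"
  proof (rule omega_functor_mu_map)
    fix x y :: "nat list \<Rightarrow>\<^sub>0 int" and k
    show "x \<in> component ?N k \<Longrightarrow> reduce_mod_2 x \<in> component ?N2 k"
      using keys_reduce_mod_2[of x] by (auto simp: normalized_chains_def)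
    show "reduce_mod_2 (x + y) = reduce_mod_2 x + reduce_mod_2 y"
      by (rule poly_mapping_eqI) (simp add: lookup_reduce_mod_2 lookup_add)
    show "bd ?N2 (reduce_mod_2 x) = reduce_mod_2 (bd ?N x)"
      by (simp add: normalized_chains_def chain_bd_reduce_mod_2)
  qed (rule omega_category_mu_normalized_chains)+
  have "inj_on (mu_map reduce_mod_2) {c. generated_cell (mu ?N) ?S m c}" for m
  proof (rule inj_on_subset[OF reduce_mod_2_inj_on_positive_unital], rule subsetI)
    fix c assume "c \<in> {c. generated_cell (mu ?N) ?S m c}"
    then have g: "generated_cell (mu ?N) ?S m c" by simp
    have "c \<in> cells (mu ?N) m"
      by (rule generated_cell_in_cells[OF omega_category_mu_normalized_chains S g])
    then show "c \<in> {c \<in> mu_carrier ?N. positive_unital n c}"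
      using oriental_cell_positive_unital[OF g] by (simp add: mu_def)
  qed
  then show ?thesis unfolding ori xi by (intro omega_iso_generated F S)
qed

end
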